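(* Let $p$ be a prime number. All zeros of $\Psi_p$ (in $\mathbb{C}_p$) are simple and are contained in $\mathbb{Q}_p$. Each ball $a+\mathbb{Z}_p\in\mathbb{Q}_p/\mathbb{Z}_p$ contains a single zero of $\Psi_p$.
   Context: $\mathbb{C}_p$ is the completion of an algebraic closure of $\mathbb{Q}_p$. $\Psi_p(T) \in T + T^2\mathbb{Z}[[T]]$ is the unique power series of this form satisfying $\sum_{j=0}^\infty p^{-j}\Psi_p(p^jT)^{p^j} = T$; it is $p$-adically entire. *)

theory Defs
  imports "HOL-Analysis.Analysis" "HOL-Computational_Algebra.Computational_Algebra"
begin

section \<open>Non-archimedean absolute values\<close>

locale nonarch_abs =
  fixes av :: "'a::field \<Rightarrow> real"
  assumes av_nonneg: "av x \<ge> 0"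
    and av_eq_0_iff: "av x = 0 \<longleftrightarrow> x = 0"
    and av_mult: "av (x * y) = av x * av y"
    and av_add_le_max: "av (x + y) \<le> max (av x) (av y)"
begin

lemma av_minus_one: "av (- 1) = 1"
proof -
  have one: "av 1 = 1"
    using av_mult[of 1 1] av_eq_0_iff[of 1] by simp
  have "av (- 1) * av (- 1) = 1"
    using av_mult[of "- 1" "- 1"] one by simp
  then show ?thesis
    using av_nonneg[of "- 1"] by (simp add: square_eq_1_iff)
qed

lemma av_minus: "av (- x) = av x"
  using av_mult[of "- 1" x] by (simp add: av_minus_one)

sublocale Metric_space UNIV "\<lambda>x y. av (x - y)"
proof
  fix x y z :: 'a
  show "0 \<le> av (x - y)" by (rule av_nonneg)
  show "av (x - y) = av (y - x)" using av_minus[of "x - y"] by simp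
  show "av (x - y) = 0 \<longleftrightarrow> x = y" by (simp add: av_eq_0_iff)
  have "av (x - z) \<le> max (av (x - y)) (av (y - z))"
    using av_add_le_max[of "x - y" "y - z"] by simp
  then show "av (x - z) \<le> av (x - y) + av (y - z)"
    using av_nonneg[of "x - y"] av_nonneg[of "y - z"] by linarith
qed

end

abbreviation av_topology :: "('a::field \<Rightarrow> real) \<Rightarrow> 'a topology" where
  "av_topology av \<equiv> Metric_space.mtopology UNIV (\<lambda>x y. av (x - y))"

abbreviation av_complete :: "('a::field \<Rightarrow> real) \<Rightarrow> bool" where
  "av_complete av \<equiv> Metric_space.mcomplete UNIV (\<lambda>x y. av (x - y))"


section \<open>Algebraic closures inside an ambient field\<close>

definition subfield_set :: "'a::field set \<Rightarrow> bool" where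
  "subfield_set L \<longleftrightarrow> 0 \<in> L \<and> 1 \<in> L \<and>
     (\<forall>x\<in>L. \<forall>y\<in>L. x + y \<in> L \<and> x * y \<in> L) \<and> (\<forall>x\<in>L. - x \<in> L \<and> inverse x \<in> L)"

definition algebraic_over :: "'a::field set \<Rightarrow> 'a \<Rightarrow> bool" where
  "algebraic_over F x \<longleftrightarrow> (\<exists>P. P \<noteq> 0 \<and> (\<forall>i. coeff P i \<in> F) \<and> poly P x = 0)"

definition algebraic_closure_of :: "'a::field set \<Rightarrow> 'a set \<Rightarrow> bool" where
  "algebraic_closure_of F L \<longleftrightarrow>
     subfield_set F \<and> subfield_set L \<and> F \<subseteq> L \<and> (\<forall>x\<in>L. algebraic_over F x) \<and>
     (\<forall>P. (\<forall>i. coeff P i \<in> L) \<and> degree P > 0 \<longrightarrow> (\<exists>x\<in>L. poly P x = 0))"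


section \<open>The fields of p-adic numbers and of complex p-adic numbers\<close>

definition padic_abs :: "nat \<Rightarrow> rat \<Rightarrow> real" where
  "padic_abs p q = (if q = 0 then 0 else
     (case quotient_of q of (a, b) \<Rightarrow>
        real p powi (int (multiplicity (int p) b) - int (multiplicity (int p) a))))"

text \<open>In a complete field whose absolute value restricts to the p-adic one on the rationals,
  the closure of the rationals is a completion of the rationals, i.e. a copy of the field of
  p-adic numbers.\<close>

definition Qp :: "('a::field_char_0 \<Rightarrow> real) \<Rightarrow> 'a set" where
  "Qp av = (av_topology av) closure_of (range of_rat)"

definition Zp :: "('a::field_char_0 \<Rightarrow> real) \<Rightarrow> 'a set" where
  "Zp av = {x \<in> Qp av. av x \<le> 1}"

text \<open>\<open>padic_Cp p av\<close>: the ambient type, with the absolute value \<open>av\<close>, is a completion of an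
  algebraic closure of the field of p-adic numbers. This determines it up to isometric
  isomorphism. That the ambient field is itself algebraically closed is a theorem, not part of
  the definition.\<close>

locale padic_Cp = nonarch_abs av for p :: nat and av :: "'a::field_char_0 \<Rightarrow> real" +
  assumes av_of_rat: "av (of_rat q) = padic_abs p q"
    and complete: "av_complete av"
    and dense_algebraic_closure:
      "\<exists>L. algebraic_closure_of (Qp av) L \<and> (av_topology av) closure_of L = UNIV"


section \<open>Zeros of power series with integer coefficients\<close>

definition map_int_fps :: "int fps \<Rightarrow> 'a::ring_1 fps" where
  "map_int_fps F = Abs_fps (\<lambda>n. of_int (fps_nth F n))"

definition fps_has_value :: "('a::field \<Rightarrow> real) \<Rightarrow> 'a fps \<Rightarrow> 'a \<Rightarrow> 'a \<Rightarrow> bool" where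
  "fps_has_value av F x v \<longleftrightarrow>
     limitin (av_topology av) (\<lambda>N. \<Sum>n<N. fps_nth F n * x ^ n) v sequentially"

definition fps_zero :: "('a::field \<Rightarrow> real) \<Rightarrow> 'a fps \<Rightarrow> 'a \<Rightarrow> bool" where
  "fps_zero av F x \<longleftrightarrow> fps_has_value av F x 0"

definition fps_simple_zero :: "('a::field \<Rightarrow> real) \<Rightarrow> 'a fps \<Rightarrow> 'a \<Rightarrow> bool" where
  "fps_simple_zero av F x \<longleftrightarrow>
     fps_zero av F x \<and> (\<exists>v. v \<noteq> 0 \<and> fps_has_value av (fps_deriv F) x v)"


section \<open>The power series Psi\<close>

text \<open>The infinite sum is taken in the ring of rational formal power series, for its usual
  topology (the \<open>sums\<close> of the library instance).\<close>

definition is_Psi :: "nat \<Rightarrow> int fps \<Rightarrow> bool" where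
  "is_Psi p F \<longleftrightarrow> fps_nth F 0 = 0 \<and> fps_nth F 1 = 1 \<and>
     (\<lambda>j. fps_const (1 / of_nat p ^ j) *
           fps_compose (map_int_fps F) (fps_const (of_nat p ^ j) * fps_X) ^ (p ^ j))
       sums (fps_X :: rat fps)"

definition Psi :: "nat \<Rightarrow> int fps" where
  "Psi p = (THE F. is_Psi p F)"

text \<open>Well-definedness: comparing coefficients turns the functional equation into a recursion
  with integral data.\<close>

lemma map_int_fps_mult: "map_int_fps (F * G) = (map_int_fps F * map_int_fps G :: 'a::ring_1 fps)"
  by (simp add: map_int_fps_def fps_eq_iff fps_mult_nth)

lemma map_int_fps_power: "map_int_fps (F ^ k) = (map_int_fps F ^ k :: 'a::ring_1 fps)"
proof (induction k)
  case 0
  show ?case by (simp add: map_int_fps_def fps_eq_iff)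
next
  case (Suc k)
  then show ?case by (simp add: map_int_fps_mult)
qed

lemma fps_power_nth_cong:
  fixes F G :: "int fps"
  assumes "fps_nth F 0 = 0" "fps_nth G 0 = 0" "\<And>m. m < n \<Longrightarrow> fps_nth F m = fps_nth G m" "k \<ge> 2"
  shows "fps_nth (F ^ k) n = fps_nth (G ^ k) n"
proof -
  have *: "fps_nth (F ^ i) m = fps_nth (G ^ i) m" if "m < n" for i m
    using that
  proof (induction i arbitrary: m)
    case (Suc i)
    then show ?case using assms(3) by (auto simp: fps_mult_nth intro!: sum.cong)
  qed simp
  from assms(4) obtain i where k: "k = Suc i" "i > 0" by (cases k) auto
  have "fps_nth F m * fps_nth (F ^ i) (n - m) = fps_nth G m * fps_nth (G ^ i) (n - m)"
    if "m \<in> {0..n}" for m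
  proof (cases "m = 0 \<or> m = n")
    case True
    then show ?thesis
      using assms(1,2) k(2) by (auto simp: startsby_zero_power)
  next
    case False
    with that show ?thesis using assms(3)[of m] *[of "n - m" i] by auto
  qed
  then show ?thesis
    by (auto simp: k fps_mult_nth intro!: sum.cong)
qed

lemma is_Psi_iff:
  assumes p: "p > 1"
  shows "is_Psi p F \<longleftrightarrow> (\<forall>n. fps_nth F n = (if n = 0 then 0 else (if n = 1 then 1 else 0) -
     (\<Sum>j=1..n. int p ^ (j * (n - 1)) * fps_nth (F ^ (p ^ j)) n)))"
proof -
  define t :: "nat \<Rightarrow> rat fps" where "t j = fps_const (1 / of_nat p ^ j) *
      fps_compose (map_int_fps F) (fps_const (of_nat p ^ j) * fps_X) ^ (p ^ j)" for j
  define c where "c n = (\<Sum>j=1..n. int p ^ (j * (n - 1)) * fps_nth (F ^ (p ^ j)) n)" for n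
  have t_nth: "fps_nth (t j) n = of_int (int p ^ (j * (n - 1)) * fps_nth (F ^ (p ^ j)) n)"
    if "n > 0" for j n
  proof -
    have X0: "fps_nth (fps_const (of_nat p ^ j) * fps_X :: rat fps) 0 = 0" by simp
    have "t j = fps_const (1 / of_nat p ^ j) *
        fps_compose (map_int_fps (F ^ (p ^ j))) (fps_const (of_nat p ^ j) * fps_X)"
      unfolding t_def map_int_fps_power fps_compose_power[OF X0] ..
    then have "fps_nth (t j) n =
        1 / of_nat p ^ j * ((of_nat p ^ j) ^ n * of_int (fps_nth (F ^ (p ^ j)) n))"
      by (simp add: fps_compose_linear map_int_fps_def)
    also have "(of_nat p ^ j) ^ n = (of_nat p ^ j * of_nat p ^ (j * (n - 1)) :: rat)"
      using that by (cases n) (simp_all add: power_mult)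
    finally show ?thesis using p by simp
  qed
  have t_0: "fps_nth (t j) 0 = 0" if "fps_nth F 0 = 0" for j
    using that p by (simp add: t_def startsby_zero_power map_int_fps_def fps_compose_nth)
  have t_large: "fps_nth (t j) n = 0" if "fps_nth F 0 = 0" "j > n" for j n
  proof (cases "n = 0")
    case False
    have "n < p ^ j" using that(2) p power_gt_expt[of p j] by simp
    then have "fps_nth (F ^ (p ^ j)) n = 0"
      using startsby_zero_power_prefix[OF that(1)] by auto
    then show ?thesis using False by (simp add: t_nth)
  qed (use t_0 that in auto)
  have part: "fps_nth (\<Sum>j<N. t j) n = of_int (if n = 0 then 0 else fps_nth F n + c n)"
    if F0: "fps_nth F 0 = 0" and N: "N > n" for N n
  proof -
    have "fps_nth (\<Sum>j<N. t j) n = (\<Sum>j<N. fps_nth (t j) n)"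
      by (simp add: fps_sum_nth)
    also have "\<dots> = (\<Sum>j\<le>n. fps_nth (t j) n)"
      using N t_large[OF F0] by (intro sum.mono_neutral_right) auto
    also have "\<dots> = of_int (if n = 0 then 0 else fps_nth F n + c n)"
    proof (cases "n = 0")
      case False
      have "{..n} = insert 0 {1..n}" by auto
      then show ?thesis using False by (simp add: t_nth c_def)
    qed (simp add: t_0[OF F0])
    finally show ?thesis .
  qed
  have sums: "t sums fps_X \<longleftrightarrow> (\<forall>n. fps_nth F n = (if n = 0 then 0 else (if n = 1 then 1 else 0) - c n))"
    if F0: "fps_nth F 0 = 0"
  proof -
    have "t sums fps_X \<longleftrightarrow>
        (\<forall>n. \<forall>\<^sub>F N in sequentially. fps_nth (\<Sum>j<N. t j) n = fps_nth fps_X n)"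
      by (simp add: sums_def tendsto_fps_iff)
    also have "\<dots> \<longleftrightarrow> (\<forall>n. of_int (if n = 0 then 0 else fps_nth F n + c n) = fps_nth (fps_X :: rat fps) n)"
    proof (intro all_cong1)
      fix n
      have "(\<forall>\<^sub>F N in sequentially. fps_nth (\<Sum>j<N. t j) n = fps_nth fps_X n) \<longleftrightarrow>
          (\<forall>\<^sub>F N in sequentially. of_int (if n = 0 then 0 else fps_nth F n + c n) = fps_nth (fps_X :: rat fps) n)"
        using part[OF F0] by (intro eventually_cong eventually_mono[OF eventually_gt_at_top[of n]]) auto
      then show "(\<forall>\<^sub>F N in sequentially. fps_nth (\<Sum>j<N. t j) n = fps_nth fps_X n) \<longleftrightarrow>
          of_int (if n = 0 then 0 else fps_nth F n + c n) = fps_nth (fps_X :: rat fps) n"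
        by simp
    qed
    also have "\<dots> \<longleftrightarrow> (\<forall>n. fps_nth F n = (if n = 0 then 0 else (if n = 1 then 1 else 0) - c n))"
    proof (intro all_cong1)
      fix n
      show "of_int (if n = 0 then 0 else fps_nth F n + c n) = fps_nth (fps_X :: rat fps) n \<longleftrightarrow>
          fps_nth F n = (if n = 0 then 0 else (if n = 1 then 1 else 0) - c n)"
        using F0 by (cases "n = 0"; cases "n = 1") (auto simp: eq_diff_eq simp flip: of_int_add)
    qed
    finally show ?thesis .
  qed
  have c1: "c 1 = 0" if "fps_nth F 0 = 0"
    using p startsby_zero_power_prefix[OF that, of p] by (simp add: c_def)
  have "(fps_nth F 0 = 0 \<and> fps_nth F 1 = 1 \<and> t sums fps_X) \<longleftrightarrow>
      (\<forall>n. fps_nth F n = (if n = 0 then 0 else (if n = 1 then 1 else 0) - c n))" (is "?L \<longleftrightarrow> ?R")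
  proof
    assume ?L
    then show ?R using sums by blast
  next
    assume R: ?R
    have F0: "fps_nth F 0 = 0" using R[rule_format, of 0] by simp
    have "fps_nth F 1 = 1" using R[rule_format, of 1] c1[OF F0] by simp
    then show ?L using F0 sums[OF F0] R by blast
  qed
  then show ?thesis
    unfolding is_Psi_def t_def c_def .
qed

fun Psi_coeff :: "nat \<Rightarrow> nat \<Rightarrow> int" where
  "Psi_coeff p n = (if n = 0 then 0 else (if n = 1 then 1 else 0) -
     (\<Sum>j=1..n. int p ^ (j * (n - 1)) *
        fps_nth (Abs_fps (\<lambda>m. if m < n then Psi_coeff p m else 0) ^ (p ^ j)) n))"

declare Psi_coeff.simps [simp del]

lemma is_Psi_ex1:
  assumes p: "p > 1"
  shows "\<exists>!F. is_Psi p F"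
proof (rule ex1I)
  have pj: "p ^ j \<ge> 2" if "j \<in> {1..n}" for j n
    using that p power_increasing[of 1 j p] by auto
  let ?F = "Abs_fps (Psi_coeff p)"
  show "is_Psi p ?F"
    unfolding is_Psi_iff[OF p]
  proof
    fix n
    have "fps_nth (Abs_fps (\<lambda>m. if m < n then Psi_coeff p m else 0) ^ (p ^ j)) n =
        fps_nth (?F ^ (p ^ j)) n" if "j \<in> {1..n}" for j
      using that pj by (intro fps_power_nth_cong) (auto simp: Psi_coeff.simps[of p 0])
    then show "fps_nth ?F n = (if n = 0 then 0 else (if n = 1 then 1 else 0) -
        (\<Sum>j=1..n. int p ^ (j * (n - 1)) * fps_nth (?F ^ (p ^ j)) n))"
      by (simp add: Psi_coeff.simps[of p n])
  qed
  fix G assume "is_Psi p G"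
  then have G: "fps_nth G n = (if n = 0 then 0 else (if n = 1 then 1 else 0) -
     (\<Sum>j=1..n. int p ^ (j * (n - 1)) * fps_nth (G ^ (p ^ j)) n))" for n
    unfolding is_Psi_iff[OF p] by blast
  have "fps_nth G n = Psi_coeff p n" for n
  proof (induction n rule: less_induct)
    case (less n)
    have "fps_nth (Abs_fps (\<lambda>m. if m < n then Psi_coeff p m else 0) ^ (p ^ j)) n =
        fps_nth (G ^ (p ^ j)) n" if "j \<in> {1..n}" for j
      using that pj less G[of 0] by (intro fps_power_nth_cong) (auto simp: Psi_coeff.simps[of p 0])
    then show ?case
      by (simp add: Psi_coeff.simps[of p n] G[of n])
  qed
  then show "G = ?F" by (simp add: fps_eq_iff)
qed

lemma is_Psi_Psi: "p > 1 \<Longrightarrow> is_Psi p (Psi p)"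
  unfolding Psi_def by (rule theI'[OF is_Psi_ex1])

end

theory Submission
  imports Defs "HOL-Number_Theory.Residues"
begin

text \<open>The recursion for the coefficients shows that \<open>p ^ (1 + p + \<dots> + p ^ (m - 1)) * \<Psi> (T / p ^ m)\<close>
  is integral, which bounds the Gauss norm of \<open>\<Psi>\<close> on every disc.

  By Fermat's little theorem the functional equation gives \<open>\<bar>\<Psi> x\<bar> \<le> 1\<close> on \<open>Q_p\<close>, and also that
  \<open>x \<mapsto> x - \<Psi> x\<close> is a contraction of every coset \<open>a + Z_p\<close>; its fixed point is a zero of \<open>\<Psi>\<close>.
  This yields \<open>p ^ k\<close> zeros in the disc \<open>\<bar>x\<bar> \<le> p ^ k\<close>, one near each \<open>i / p ^ k\<close>. If there was one more
  zero in this disc, counted with multiplicity, then dividing by all of these zeros would make the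
  Gauss norm on the disc of radius \<open>p ^ (k + 1)\<close> too small for the coefficient \<open>1\<close> of \<open>T\<close> in \<open>\<Psi>\<close>.
  Hence there are no others, which gives simplicity, rationality and uniqueness at once.\<close>

subsection \<open>Power series over a non-archimedean field\<close>

context nonarch_abs
begin

section \<open>Ultrametric estimates\<close>

lemma av_0 [simp]: "av 0 = 0"
  by (simp add: av_eq_0_iff)

lemma av_1 [simp]: "av 1 = 1"
  using av_mult[of 1 1] av_eq_0_iff[of 1] by simp

lemma av_power: "av (x ^ n) = av x ^ n"
  by (induction n) (simp_all add: av_mult)

lemma av_inverse: "av (inverse x) = inverse (av x)"
proof (cases "x = 0")
  case False
  then have "av x * av (inverse x) = 1"
    using av_mult[of x "inverse x"] by simp
  then show ?thesis
    by (metis inverse_unique)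
qed simp

lemma av_divide: "av (x / y) = av x / av y"
  by (simp add: divide_inverse av_mult av_inverse)

lemma av_prod: "av (\<Prod>i\<in>A. f i) = (\<Prod>i\<in>A. av (f i))"
  by (induction A rule: infinite_finite_induct) (simp_all add: av_mult)

lemma av_add_le: "av x \<le> B \<Longrightarrow> av y \<le> B \<Longrightarrow> av (x + y) \<le> B"
  using av_add_le_max[of x y] by simp

lemma av_diff_le: "av x \<le> B \<Longrightarrow> av y \<le> B \<Longrightarrow> av (x - y) \<le> B"
  using av_add_le[of x B "- y"] by (simp add: av_minus)

lemma av_diff_commute: "av (x - y) = av (y - x)"
  using av_minus[of "x - y"] by simp

lemma av_triangle: "av (x + y) \<le> av x + av y"
  using av_add_le_max[of x y] av_nonneg[of x] av_nonneg[of y] by linarith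

lemma av_sum_le:
  assumes "0 \<le> B" "\<And>i. i \<in> A \<Longrightarrow> av (f i) \<le> B"
  shows "av (\<Sum>i\<in>A. f i) \<le> B"
  using assms by (induction A rule: infinite_finite_induct) (auto intro: av_add_le)

lemma av_of_nat_le_1: "av (of_nat n) \<le> 1"
  by (induction n) (auto intro: av_add_le)

lemma av_of_int_le_1: "av (of_int n) \<le> 1"
  using av_of_nat_le_1[of "nat \<bar>n\<bar>"] av_minus[of "of_int n"] by (cases "n \<ge> 0") auto

lemma av_power_diff_le:
  assumes "av x \<le> 1" "av y \<le> 1"
  shows "av (x ^ n - y ^ n) \<le> av (x - y)"
proof (induction n)
  case (Suc n)
  have "x ^ Suc n - y ^ Suc n = x * (x ^ n - y ^ n) + (x - y) * y ^ n"
    by (simp add: algebra_simps)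
  moreover have "av (x * (x ^ n - y ^ n)) \<le> av (x - y)"
    using Suc mult_mono[OF assms(1) Suc] by (simp add: av_mult av_nonneg)
  moreover have "av ((x - y) * y ^ n) \<le> av (x - y)"
    using assms(2) by (simp add: av_mult av_power av_nonneg power_le_one mult_left_le)
  ultimately show ?case
    using av_add_le by metis
qed (simp add: av_nonneg)

section \<open>Convergence and completeness\<close>

definition conv :: "(nat \<Rightarrow> 'a) \<Rightarrow> 'a \<Rightarrow> bool" where
  "conv s v \<longleftrightarrow> (\<lambda>N. av (s N - v)) \<longlonglongrightarrow> 0"

text \<open>Turns convergence in the metric topology into a real null sequence, so that real limit
  rules apply.\<close>

lemma limitin_iff_conv: "limitin (av_topology av) s v sequentially \<longleftrightarrow> conv s v"
  by (simp add: limitin_metric_dist_null conv_def)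

lemma fps_has_value_iff_conv: "fps_has_value av F x v \<longleftrightarrow> conv (\<lambda>N. \<Sum>n<N. fps_nth F n * x ^ n) v"
  by (simp add: fps_has_value_def limitin_iff_conv)

lemma conv_iff_diff: "conv s v \<longleftrightarrow> conv (\<lambda>N. s N - v) 0"
  by (simp add: conv_def)

lemma conv_null_eventuallyI:
  assumes "t \<longlonglongrightarrow> 0" "\<forall>\<^sub>F N in sequentially. av (s N) \<le> t N"
  shows "conv s 0"
  unfolding conv_def
  by (rule tendsto_sandwich[of "\<lambda>_. 0" _ _ t]) (use assms in \<open>auto simp: av_nonneg\<close>)

lemma conv_nullI: "t \<longlonglongrightarrow> 0 \<Longrightarrow> (\<And>N. av (s N) \<le> t N) \<Longrightarrow> conv s 0"
  by (erule conv_null_eventuallyI) simp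

lemma conv_const: "conv (\<lambda>_. c) c"
  by (simp add: conv_def)

lemma conv_add:
  assumes "conv s u" "conv t v"
  shows "conv (\<lambda>N. s N + t N) (u + v)"
proof -
  have "conv (\<lambda>N. s N + t N - (u + v)) 0"
  proof (rule conv_nullI)
    show "(\<lambda>N. av (s N - u) + av (t N - v)) \<longlonglongrightarrow> 0"
      using tendsto_add[OF assms[unfolded conv_def]] by simp
    show "av (s N + t N - (u + v)) \<le> av (s N - u) + av (t N - v)" for N
      using av_triangle[of "s N - u" "t N - v"] by (simp add: algebra_simps)
  qed
  then show ?thesis
    by (subst conv_iff_diff)
qed

lemma conv_mult_null:
  assumes "conv s 0" "\<And>N. av (t N) \<le> B"
  shows "conv (\<lambda>N. t N * s N) 0"
proof (rule conv_nullI)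
  show "(\<lambda>N. B * av (s N)) \<longlonglongrightarrow> 0"
    using tendsto_mult_left[OF assms(1)[unfolded conv_def], of B] by simp
  show "av (t N * s N) \<le> B * av (s N)" for N
    using assms(2)[of N] by (simp add: av_mult av_nonneg mult_right_mono)
qed

lemma conv_cmult:
  assumes "conv s v"
  shows "conv (\<lambda>N. c * s N) (c * v)"
proof -
  have "conv (\<lambda>N. c * (s N - v)) 0"
    using assms conv_iff_diff by (intro conv_mult_null[where B = "av c"]) auto
  then show ?thesis
    by (subst conv_iff_diff) (simp add: algebra_simps)
qed

lemma conv_diff:
  assumes "conv s u" "conv t v"
  shows "conv (\<lambda>N. s N - t N) (u - v)"
  using conv_add[OF assms(1) conv_cmult[OF assms(2), of "- 1"]] by simp

lemma conv_sum:
  assumes "\<And>i. i \<in> A \<Longrightarrow> conv (s i) (v i)"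
  shows "conv (\<lambda>N. \<Sum>i\<in>A. s i N) (\<Sum>i\<in>A. v i)"
  using assms
  by (induction A rule: infinite_finite_induct) (auto intro: conv_add simp: conv_const)

lemma conv_Suc_iff: "conv (\<lambda>N. s (Suc N)) v \<longleftrightarrow> conv s v"
  unfolding conv_def by (rule filterlim_sequentially_Suc)

text \<open>Closed balls are closed. This carries bounds on partial sums over to values of power
  series.\<close>

lemma av_le_of_conv:
  assumes "conv s v" "\<forall>\<^sub>F N in sequentially. av (s N) \<le> B"
  shows "av v \<le> B"
proof (rule field_le_epsilon)
  fix e :: real assume "e > 0"
  then have "\<forall>\<^sub>F N in sequentially. av (s N - v) < e"
    using assms(1) order_tendstoD(2) unfolding conv_def by blast
  with assms(2) have "\<forall>\<^sub>F N in sequentially. av v \<le> B + e"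
  proof eventually_elim
    case (elim N)
    then show ?case
      using av_triangle[of "s N" "v - s N"] av_diff_commute[of v "s N"] by simp
  qed
  then show "av v \<le> B + e" by simp
qed

lemma conv_unique:
  assumes "conv s u" "conv s v"
  shows "u = v"
proof -
  have "av (u - v) \<le> 0"
    by (rule av_le_of_conv[OF conv_diff[OF assms]]) simp
  then show ?thesis
    using av_nonneg[of "u - v"] av_eq_0_iff[of "u - v"] by simp
qed

lemma conv_mult:
  assumes "conv s u" "conv t v"
  shows "conv (\<lambda>N. s N * t N) (u * v)"
proof -
  have "(\<lambda>N. av (s N - u) * av (t N - v)) \<longlonglongrightarrow> 0"
    using tendsto_mult[OF assms[unfolded conv_def]] by simp
  then have "conv (\<lambda>N. (s N - u) * (t N - v)) 0"
    by (rule conv_nullI) (simp add: av_mult)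
  then have "conv (\<lambda>N. (s N - u) * (t N - v) + u * t N + v * s N - u * v) (0 + u * v + v * u - u * v)"
    using assms by (intro conv_add conv_diff conv_cmult conv_const)
  then show ?thesis
    by (simp add: algebra_simps)
qed

text \<open>By the ultrametric inequality a block of consecutive terms is no larger than its largest
  term, so null terms already make the partial sums Cauchy.\<close>

lemma partial_sums_conv:
  assumes "av_complete av" "(\<lambda>n. av (t n)) \<longlonglongrightarrow> 0"
  obtains v where "conv (\<lambda>N. \<Sum>n<N. t n) v"
proof -
  have "MCauchy (\<lambda>N. \<Sum>n<N. t n)"
    unfolding MCauchy_def
  proof (intro conjI allI impI)
    fix e :: real assume "e > 0"
    then have "\<forall>\<^sub>F n in sequentially. av (t n) < e / 2"
      using order_tendstoD(2)[OF assms(2), of "e / 2"] by simp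
    then obtain N where N: "\<And>n. n \<ge> N \<Longrightarrow> av (t n) < e / 2"
      by (auto simp: eventually_sequentially)
    have *: "av ((\<Sum>n<k. t n) - (\<Sum>n<k'. t n)) < e" if "N \<le> k'" "k' \<le> k" for k k'
    proof -
      have "(\<Sum>n<k. t n) - (\<Sum>n<k'. t n) = (\<Sum>n=k'..<k. t n)"
        using that(2) sum_diff_nat_ivl[of 0 k' k t] by (simp add: atLeast0LessThan)
      also have "av \<dots> \<le> e / 2"
        using that(1) N \<open>e > 0\<close> by (intro av_sum_le) (auto intro: less_imp_le)
      finally show ?thesis using \<open>e > 0\<close> by simp
    qed
    have "av ((\<Sum>n<k. t n) - (\<Sum>n<k'. t n)) < e" if "N \<le> k" "N \<le> k'" for k k'
    proof (cases "k' \<le> k")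
      case False
      then show ?thesis
        using *[of k k'] that by (subst av_diff_commute) simp
    qed (use * that in blast)
    then show "\<exists>N. \<forall>n n'. N \<le> n \<longrightarrow> N \<le> n' \<longrightarrow> av ((\<Sum>n<n. t n) - (\<Sum>n<n'. t n)) < e"
      by blast
  qed simp
  then show ?thesis
    using assms(1) that unfolding mcomplete_def limitin_iff_conv by blast
qed

text \<open>Bounds the Gauss norm on the disc of radius r. A bound is carried along instead of the
  supremum itself, since only upper estimates enter.\<close>

definition gauss_le :: "'a fps \<Rightarrow> real \<Rightarrow> real \<Rightarrow> bool" where
  "gauss_le F r B \<longleftrightarrow> (\<forall>n. av (fps_nth F n) * r ^ n \<le> B)"

lemma gauss_le_nonneg: "gauss_le F r B \<Longrightarrow> 0 \<le> B"
  using av_nonneg[of "fps_nth F 0"] unfolding gauss_le_def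
  by (metis mult.right_neutral order_trans power_0)

lemma gauss_le_term:
  assumes "gauss_le F r B" "av x \<le> r" "0 < r"
  shows "av (fps_nth F n * x ^ n) \<le> B * (av x / r) ^ n"
proof -
  have "av (fps_nth F n * x ^ n) = av (fps_nth F n) * r ^ n * (av x / r) ^ n"
    using assms(3) by (simp add: av_mult av_power power_divide)
  also have "\<dots> \<le> B * (av x / r) ^ n"
    using assms av_nonneg[of x] unfolding gauss_le_def by (intro mult_right_mono) auto
  finally show ?thesis .
qed

lemma gauss_le_term_tendsto:
  assumes "gauss_le F r B" "av x < r"
  shows "conv (\<lambda>n. fps_nth F n * x ^ n) 0"
proof (rule conv_nullI)
  have "0 < r" using assms(2) av_nonneg[of x] by linarith
  then show "av (fps_nth F n * x ^ n) \<le> B * (av x / r) ^ n" for n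
    using assms by (intro gauss_le_term) auto
  have "norm (av x / r) < 1"
    using \<open>0 < r\<close> assms(2) av_nonneg[of x] by simp
  from tendsto_mult_left[OF LIMSEQ_power_zero[OF this], of B]
  show "(\<lambda>n. B * (av x / r) ^ n) \<longlonglongrightarrow> 0" by simp
qed

lemma gauss_le_mult:
  assumes "gauss_le F r B" "gauss_le G r C" "0 < r"
  shows "gauss_le (F * G) r (B * C)"
  unfolding gauss_le_def
proof
  fix n
  have BC: "0 \<le> B" "0 \<le> C" using assms gauss_le_nonneg by blast+
  have "av (fps_nth F i * fps_nth G (n - i)) \<le> B * C / r ^ n" if "i \<in> {0..n}" for i
  proof -
    have "r ^ n = r ^ i * r ^ (n - i)" using that by (simp flip: power_add)
    then have "av (fps_nth F i * fps_nth G (n - i)) * r ^ n =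
        (av (fps_nth F i) * r ^ i) * (av (fps_nth G (n - i)) * r ^ (n - i))"
      by (simp add: av_mult)
    also have "\<dots> \<le> B * C"
      using assms BC unfolding gauss_le_def by (intro mult_mono) (auto simp: av_nonneg)
    finally show ?thesis using assms(3) by (simp add: field_simps)
  qed
  then have "av (fps_nth (F * G) n) \<le> B * C / r ^ n"
    unfolding fps_mult_nth using BC assms(3) by (intro av_sum_le) auto
  then show "av (fps_nth (F * G) n) * r ^ n \<le> B * C"
    using assms(3) by (simp add: field_simps)
qed

text \<open>The product of two partial sums and the partial sum of the product differ by terms with
  \<open>i + j \<ge> N\<close>; each is at most \<open>B * C * q ^ N\<close> with
  \<open>q = av x / r < 1\<close>.\<close>

lemma fps_has_value_mult:
  assumes F: "gauss_le F r B" "fps_has_value av F x u"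
    and G: "gauss_le G r C" "fps_has_value av G x v"
    and x: "av x < r"
  shows "fps_has_value av (F * G) x (u * v)"
proof -
  let ?P = "\<lambda>F N. \<Sum>n<N. fps_nth F n * x ^ n"
  define q where "q = av x / r"
  have r: "0 < r" using x av_nonneg[of x] by linarith
  have q: "0 \<le> q" "q < 1" using r x av_nonneg[of x] by (auto simp: q_def)
  have BC: "0 \<le> B" "0 \<le> C" using F G gauss_le_nonneg by blast+
  have "conv (\<lambda>N. ?P F N * ?P G N - ?P (F * G) N) 0"
  proof (rule conv_nullI)
    show "(\<lambda>N. B * C * q ^ N) \<longlonglongrightarrow> 0"
      using tendsto_mult_left[OF LIMSEQ_power_zero, of q "B * C"] q by simp
    fix N :: nat
    define t where "t = (\<lambda>(i, j). fps_nth F i * x ^ i * (fps_nth G j * x ^ j))"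
    let ?D = "{(i, j). i + j < N}"
    have fin: "finite ?D"
      by (rule finite_subset[of _ "{..<N} \<times> {..<N}"]) auto
    have "?P (F * G) N = (\<Sum>n<N. \<Sum>i\<le>n. t (i, n - i))"
      by (auto simp: fps_mult_nth sum_distrib_left sum_distrib_right t_def atLeast0AtMost mult_ac
          simp flip: power_add intro!: sum.cong)
    also have "\<dots> = sum t ?D"
      using sum.triangle_reindex[of "\<lambda>i j. t (i, j)" N] by simp
    finally have PD: "?P (F * G) N = sum t ?D" by simp
    have "?P F N * ?P G N = (\<Sum>i<N. \<Sum>j<N. t (i, j))"
      by (simp add: sum_product t_def)
    also have "\<dots> = sum t ({..<N} \<times> {..<N})"
      by (simp add: sum.cartesian_product)
    also have "\<dots> - sum t ?D = sum t ({..<N} \<times> {..<N} - ?D)"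
      by (rule sum_diff[symmetric]) auto
    finally have "?P F N * ?P G N - ?P (F * G) N = sum t ({..<N} \<times> {..<N} - ?D)"
      by (simp add: PD)
    also have "av \<dots> \<le> B * C * q ^ N"
    proof (rule av_sum_le)
      show "0 \<le> B * C * q ^ N" using BC q by simp
      fix k assume k: "k \<in> {..<N} \<times> {..<N} - ?D"
      obtain i j where ij: "k = (i, j)" by (cases k)
      have "av (t k) \<le> (B * q ^ i) * (C * q ^ j)"
        unfolding ij t_def q_def
        using gauss_le_term[OF F(1), of x i] gauss_le_term[OF G(1), of x j] x r BC q
        by (auto simp: av_mult av_nonneg q_def intro!: mult_mono)
      also have "\<dots> = B * C * q ^ (i + j)" by (simp add: power_add)
      also have "\<dots> \<le> B * C * q ^ N"
        using k ij q BC by (intro mult_left_mono power_decreasing) auto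
      finally show "av (t k) \<le> B * C * q ^ N" .
    qed
    finally show "av (?P F N * ?P G N - ?P (F * G) N) \<le> B * C * q ^ N" .
  qed
  from conv_diff[OF conv_mult[OF F(2)[unfolded fps_has_value_iff_conv]
        G(2)[unfolded fps_has_value_iff_conv]] this]
  show ?thesis
    by (simp add: fps_has_value_iff_conv)
qed

lemma fps_has_value_power:
  assumes F: "gauss_le F r B" "fps_has_value av F x u" and x: "av x < r"
  shows "fps_has_value av (F ^ k) x (u ^ k) \<and> gauss_le (F ^ k) r (B ^ k)"
proof (induction k)
  case 0
  \<comment> \<open>The shift to \<open>Suc N\<close> skips the empty partial sum, which is 0 rather
    than 1.\<close>
  have "conv (\<lambda>N. \<Sum>n<Suc N. fps_nth 1 n * x ^ n) 1"
    by (simp add: sum.lessThan_Suc_shift conv_const del: sum.lessThan_Suc)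
  then have "fps_has_value av 1 x 1"
    unfolding fps_has_value_iff_conv using conv_Suc_iff by blast
  then show ?case by (simp add: gauss_le_def)
next
  case (Suc k)
  have "0 < r" using x av_nonneg[of x] by linarith
  then show ?case
    using Suc F x fps_has_value_mult[OF F, of "F ^ k" "B ^ k"] gauss_le_mult[OF F(1)] by simp
qed

text \<open>Dividing out T - c lowers the Gauss bound by the factor r, because c lies inside the
  disc. Other zeros survive, and G takes at c the value of the derivative of F, so that a zero of G
  at c is a multiple zero of F.\<close>

lemma fps_zero_division:
  assumes F: "gauss_le F r B" "fps_zero av F c" and c: "av c < r"
  obtains G where "F = (fps_X - fps_const c) * G" "gauss_le G r (B / r)"
    "\<And>x. fps_zero av F x \<Longrightarrow> av x < r \<Longrightarrow> x \<noteq> c \<Longrightarrow> fps_zero av G x"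
    "\<And>v. fps_has_value av G c v \<Longrightarrow> fps_has_value av (fps_deriv F) c v"
proof -
  have r: "0 < r" using c av_nonneg[of c] by linarith
  have B: "0 \<le> B" using F(1) gauss_le_nonneg by blast
  let ?P = "\<lambda>F x N. \<Sum>n<N. fps_nth F n * x ^ n"
  \<comment> \<open>For \<open>c \<noteq> 0\<close> this is the tail sum of a_i c^(i-n-1) over i >
    n, the n-th coefficient of F/(T - c); as F vanishes at c, it equals minus the complementary
    partial sum divided by c^(n+1). For \<open>c = 0\<close> the division is a shift.\<close>
  define g where "g n = (if c = 0 then fps_nth F (Suc n) else - (?P F c (Suc n) / c ^ Suc n))" for n
  define G where "G = Abs_fps g"
  have F0: "fps_nth F 0 = - c * g 0"
  proof (cases "c = 0")
    case True
    have "conv (\<lambda>N. ?P F 0 (Suc N)) (fps_nth F 0)"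
      by (simp add: sum.lessThan_Suc_shift conv_const del: sum.lessThan_Suc)
    then have "conv (?P F 0) (fps_nth F 0)" using conv_Suc_iff[of "?P F 0"] by blast
    moreover have "conv (?P F 0) 0"
      using True F(2) unfolding fps_zero_def fps_has_value_iff_conv by simp
    ultimately show ?thesis
      using True conv_unique[of "?P F 0" "fps_nth F 0" 0] by simp
  qed (simp add: g_def)
  have FS: "fps_nth F (Suc n) = g n - c * g (Suc n)" for n
  proof (cases "c = 0")
    case False
    then have "c * g (Suc n) = - (?P F c (Suc (Suc n)) / c ^ Suc n)"
      by (simp add: g_def del: sum.lessThan_Suc)
    also have "\<dots> = g n - fps_nth F (Suc n)"
      using False by (subst sum.lessThan_Suc) (simp add: g_def add_divide_distrib del: sum.lessThan_Suc power_Suc)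
    finally show ?thesis by simp
  qed (simp add: g_def)
  have prod: "F = (fps_X - fps_const c) * G"
  proof (rule fps_ext)
    show "fps_nth F n = fps_nth ((fps_X - fps_const c) * G) n" for n
      by (cases n) (simp_all add: F0 FS G_def left_diff_distrib)
  qed
  have gauss: "gauss_le G r (B / r)"
    unfolding gauss_le_def
  proof
    fix n
    have "av (g n) * r ^ Suc n \<le> B"
    proof (cases "c = 0")
      case True
      then show ?thesis
        using F(1)[unfolded gauss_le_def, rule_format, of "Suc n"] by (simp add: g_def)
    next
      case False
      define q where "q = av c / r"
      have c0: "0 < av c" using False av_eq_0_iff[of c] av_nonneg[of c] by linarith
      have q: "0 < q" "q \<le> 1" using c0 r c by (simp_all add: q_def)
      \<comment> \<open>The limit is the tail of F(c) from degree n + 1 on, whose terms are all at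
        most \<open>B * q ^ Suc n\<close>.\<close>
      have "conv (\<lambda>N. ?P F c N - ?P F c (Suc n)) (0 - ?P F c (Suc n))"
        using F(2) unfolding fps_zero_def fps_has_value_iff_conv by (intro conv_diff conv_const)
      moreover have "\<forall>\<^sub>F N in sequentially. av (?P F c N - ?P F c (Suc n)) \<le> B * q ^ Suc n"
        using eventually_ge_at_top[of "Suc n"]
      proof eventually_elim
        case (elim N)
        have "?P F c N - ?P F c (Suc n) = (\<Sum>i=Suc n..<N. fps_nth F i * c ^ i)"
          using elim sum_diff_nat_ivl[of 0 "Suc n" N "\<lambda>i. fps_nth F i * c ^ i"]
          by (simp add: atLeast0LessThan)
        also have "av \<dots> \<le> B * q ^ Suc n"
        proof (rule av_sum_le)
          show "0 \<le> B * q ^ Suc n" using B q by simp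
          fix i assume i: "i \<in> {Suc n..<N}"
          have "av (fps_nth F i * c ^ i) \<le> B * q ^ i"
            using gauss_le_term[OF F(1), of c i] c r by (simp add: q_def)
          also have "\<dots> \<le> B * q ^ Suc n"
            using i q B by (intro mult_left_mono power_decreasing) auto
          finally show "av (fps_nth F i * c ^ i) \<le> B * q ^ Suc n" .
        qed
        finally show ?case .
      qed
      ultimately have "av (0 - ?P F c (Suc n)) \<le> B * q ^ Suc n"
        by (rule av_le_of_conv)
      then have "av (?P F c (Suc n)) \<le> B * q ^ Suc n"
        using av_minus[of "?P F c (Suc n)"] by (simp del: sum.lessThan_Suc)
      moreover have "av (g n) = av (?P F c (Suc n)) / av c ^ Suc n"
        using False by (simp add: g_def av_minus av_divide av_power del: sum.lessThan_Suc power_Suc)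
      ultimately have "av (g n) * r ^ Suc n \<le> B * q ^ Suc n / av c ^ Suc n * r ^ Suc n"
        using r c0 by (simp only:) (intro mult_right_mono divide_right_mono, auto)
      also have "\<dots> = B"
        using r c0 by (simp add: q_def power_divide del: power_Suc)
      finally show ?thesis .
    qed
    then show "av (fps_nth G n) * r ^ n \<le> B / r"
      using r by (simp add: G_def field_simps)
  qed
  have null: "conv (\<lambda>N. fps_nth G N * x ^ N) 0" if "av x < r" for x
    using gauss_le_term_tendsto[OF gauss that] .
  have "fps_zero av G x" if x: "fps_zero av F x" "av x < r" "x \<noteq> c" for x
  proof -
    \<comment> \<open>A finite form of F(x) = (x - c) G(x); the boundary term tends to 0 inside the
      disc.\<close>
    have "?P F x (Suc N) = (x - c) * ?P G x (Suc N) - x * (fps_nth G N * x ^ N)" for N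
    proof (induction N)
      case (Suc N)
      have "?P F x (Suc (Suc N)) = ?P F x (Suc N) + fps_nth F (Suc N) * x ^ Suc N"
        by (rule sum.lessThan_Suc)
      also have "\<dots> = (x - c) * ?P G x (Suc N) - x * (g N * x ^ N) + (g N - c * g (Suc N)) * x ^ Suc N"
        unfolding Suc by (simp only: FS G_def fps_nth_Abs_fps)
      also have "\<dots> = (x - c) * (?P G x (Suc N) + g (Suc N) * x ^ Suc N) - x * (g (Suc N) * x ^ Suc N)"
        by (simp add: algebra_simps del: sum.lessThan_Suc)
      also have "\<dots> = (x - c) * ?P G x (Suc (Suc N)) - x * (fps_nth G (Suc N) * x ^ Suc N)"
        by (simp add: sum.lessThan_Suc[of _ "Suc N"] G_def del: sum.lessThan_Suc)
      finally show ?case .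
    qed (simp add: F0 G_def algebra_simps)
    then have "?P F x (Suc N) + x * (fps_nth G N * x ^ N) = (x - c) * ?P G x (Suc N)" for N
      by (simp only: diff_add_cancel)
    then have *: "inverse (x - c) * (?P F x (Suc N) + x * (fps_nth G N * x ^ N)) =
        inverse (x - c) * ((x - c) * ?P G x (Suc N))" for N
      by (rule arg_cong)
    have "inverse (x - c) * ((x - c) * y) = y" for y
      using x(3) by (simp add: mult.assoc[symmetric])
    then have eq: "?P G x (Suc N) = inverse (x - c) * (?P F x (Suc N) + x * (fps_nth G N * x ^ N))" for N
      unfolding * by (rule sym)
    have "conv (\<lambda>N. ?P F x (Suc N)) 0"
      using x(1) conv_Suc_iff[of "?P F x"] unfolding fps_zero_def fps_has_value_iff_conv by blast
    then have "conv (\<lambda>N. inverse (x - c) * (?P F x (Suc N) + x * (fps_nth G N * x ^ N)))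
        (inverse (x - c) * (0 + x * 0))"
      using null[OF x(2)] by (intro conv_cmult conv_add)
    then have "conv (\<lambda>N. ?P G x (Suc N)) 0"
      unfolding eq by simp
    then show ?thesis
      unfolding fps_zero_def fps_has_value_iff_conv using conv_Suc_iff by blast
  qed
  moreover have "fps_has_value av (fps_deriv F) c v" if v: "fps_has_value av G c v" for v
  proof -
    \<comment> \<open>Differentiating F = (T - c) G at c leaves G(c). The factor N of the boundary
      term has absolute value at most 1, so this term still tends to 0.\<close>
    have "?P (fps_deriv F) c N = ?P G c N - of_nat N * (fps_nth G N * c ^ N)" for N
    proof (induction N)
      case (Suc N)
      have "?P (fps_deriv F) c (Suc N) = ?P (fps_deriv F) c N + of_nat (Suc N) * (g N - c * g (Suc N)) * c ^ N"
        by (simp add: FS)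
      also have "\<dots> = ?P G c N - of_nat N * (g N * c ^ N) + of_nat (Suc N) * (g N - c * g (Suc N)) * c ^ N"
        unfolding Suc by (simp only: G_def fps_nth_Abs_fps)
      also have "\<dots> = ?P G c N + g N * c ^ N - of_nat (Suc N) * (g (Suc N) * c ^ Suc N)"
        by (simp add: algebra_simps)
      also have "\<dots> = ?P G c (Suc N) - of_nat (Suc N) * (fps_nth G (Suc N) * c ^ Suc N)"
        by (simp add: G_def)
      finally show ?case .
    qed simp
    moreover have "conv (\<lambda>N. ?P G c N - of_nat N * (fps_nth G N * c ^ N)) (v - 0)"
      using v null[OF c] unfolding fps_has_value_iff_conv
      by (intro conv_diff conv_mult_null[where t = of_nat and B = 1] av_of_nat_le_1)
    ultimately show ?thesis
      unfolding fps_has_value_iff_conv by simp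
  qed
  ultimately show ?thesis
    by (rule that[OF prod gauss])
qed

text \<open>Zeros are divided out one by one. As the elements of S are distinct, each remaining one
  is still a zero of the current quotient by \<open>fps_zero_division\<close>.\<close>

lemma fps_zeros_division:
  assumes "gauss_le F r B" "finite S" "\<And>s. s \<in> S \<Longrightarrow> fps_zero av F s \<and> av s < r"
  obtains G where "F = (\<Prod>s\<in>S. fps_X - fps_const s) * G" "gauss_le G r (B / r ^ card S)"
proof -
  have "\<exists>G. F = (\<Prod>s\<in>S. fps_X - fps_const s) * G \<and> gauss_le G r (B / r ^ card S)"
    using assms(2,1,3)
  proof (induction S arbitrary: F B rule: finite_induct)
    case (insert c S)
    obtain G where G: "F = (fps_X - fps_const c) * G" "gauss_le G r (B / r)"
      "\<And>x. fps_zero av F x \<Longrightarrow> av x < r \<Longrightarrow> x \<noteq> c \<Longrightarrow> fps_zero av G x"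
    proof (rule fps_zero_division)
      show "gauss_le F r B" by (rule insert.prems)
      show "fps_zero av F c" "av c < r" using insert.prems(2)[of c] by simp_all
    qed (rule that)
    have "\<exists>H. G = (\<Prod>s\<in>S. fps_X - fps_const s) * H \<and> gauss_le H r (B / r / r ^ card S)"
    proof (rule insert.IH[OF G(2)])
      fix s assume "s \<in> S"
      then show "fps_zero av G s \<and> av s < r"
        using G(3)[of s] insert.prems(2)[of s] insert.hyps by auto
    qed
    then show ?case
      using G(1) insert.hyps by (auto simp: mult.assoc)
  qed auto
  then show ?thesis using that by blast
qed

end

subsection \<open>Coefficients of \<open>\<Psi>\<close>\<close>

text \<open>The number (p^m - 1)/(p - 1): for prime p the exponent of p in (p^m)!, and also the
  exponent in the Gauss bound for \<Psi> on the disc of radius p^m. The count of zeros rests on this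
  agreement.\<close>

definition repunit :: "nat \<Rightarrow> nat \<Rightarrow> nat" where
  "repunit p m = (\<Sum>i<m. p ^ i)"

lemma repunit_add: "repunit p (j + k) = repunit p j + p ^ j * repunit p k"
  by (induction k) (simp_all add: repunit_def algebra_simps power_add)

lemma le_repunit: "p > 0 \<Longrightarrow> m \<le> repunit p m"
proof (induction m)
  case (Suc m)
  have "1 \<le> p ^ m" using Suc.prems by simp
  with Suc.IH[OF Suc.prems] have "Suc m \<le> repunit p m + p ^ m" by linarith
  then show ?case by (simp add: repunit_def)
qed simp

text \<open>The p^k multiples of p among 1, ..., p^(k+1) have product p^(p^k) times (p^k)!, which
  gives the recursion for the exponent.\<close>

lemma prime_power_repunit_dvd_fact:
  assumes "p > 0"
  shows "p ^ repunit p k dvd (fact (p ^ k) :: nat)"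
proof (induction k)
  case (Suc k)
  have "(\<Prod>i\<in>{1..p ^ k}. p * i) = \<Prod>((*) p ` {1..p ^ k})"
    using assms by (subst prod.reindex) (auto simp: inj_on_def)
  also have "\<dots> dvd \<Prod>{1..p ^ Suc k}"
    using assms by (intro prod_dvd_prod_subset) auto
  finally have "p ^ p ^ k * fact (p ^ k) dvd (fact (p ^ Suc k) :: nat)"
    by (simp add: prod.distrib fact_prod)
  moreover have "p ^ repunit p (Suc k) dvd p ^ p ^ k * fact (p ^ k)"
    using Suc by (simp add: repunit_def power_add mult_dvd_mono mult.commute)
  ultimately show ?case
    by (rule dvd_trans[rotated])
qed (simp add: repunit_def)

text \<open>The hypothesis says that c F(T/q) has integral coefficients; then so does its k-th
  power.\<close>

lemma dvd_fps_nth_power: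
  fixes F :: "int fps"
  assumes "\<And>n. q ^ n dvd c * fps_nth F n"
  shows "q ^ n dvd c ^ k * fps_nth (F ^ k) n"
proof (induction k arbitrary: n)
  case (Suc k)
  have "c ^ Suc k * fps_nth (F ^ Suc k) n =
      (\<Sum>i=0..n. (c * fps_nth F i) * (c ^ k * fps_nth (F ^ k) (n - i)))"
    by (simp add: fps_mult_nth sum_distrib_left mult_ac)
  also have "q ^ n dvd \<dots>"
  proof (rule dvd_sum)
    fix i assume "i \<in> {0..n}"
    then show "q ^ n dvd (c * fps_nth F i) * (c ^ k * fps_nth (F ^ k) (n - i))"
      using mult_dvd_mono[OF assms[of i] Suc[of "n - i"]] by (simp flip: power_add)
  qed
  finally show ?case .
qed (auto simp: fps_one_nth)

lemma Psi_nth_0: "p > 1 \<Longrightarrow> fps_nth (Psi p) 0 = 0"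
  using is_Psi_Psi is_Psi_def by blast

lemma Psi_nth_1: "p > 1 \<Longrightarrow> fps_nth (Psi p) 1 = 1"
  using is_Psi_Psi is_Psi_def by blast

lemma Psi_nth:
  assumes "p > 1" "n > 0"
  shows "fps_nth (Psi p) n = (if n = 1 then 1 else 0) -
     (\<Sum>j=1..n. int p ^ (j * (n - 1)) * fps_nth (Psi p ^ (p ^ j)) n)"
  using is_Psi_Psi[OF assms(1)] assms(2) unfolding is_Psi_iff[OF assms(1)] by simp

lemma Psi_power_nth_eq_0: "p > 1 \<Longrightarrow> n < p ^ j \<Longrightarrow> fps_nth (Psi p ^ (p ^ j)) n = 0"
  using startsby_zero_power_prefix[OF Psi_nth_0] by auto

text \<open>Integrality of \<open>p ^ repunit p m\<close> times \<Psi>(T/p^m), by the recursion. For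
  \<open>j \<le> m\<close>, substituting T/p^m turns \<Psi>(p^j T) into \<Psi>(T/p^(m-j)), to which
  the induction hypothesis applies; for \<open>j > m\<close> the power of p in front of the
  coefficient suffices.\<close>

lemma Psi_nth_dvd:
  assumes p: "p > 1"
  shows "(int p ^ m) ^ n dvd int p ^ repunit p m * fps_nth (Psi p) n"
proof (induction m arbitrary: n rule: less_induct)
  case (less m)
  show ?case
  proof (cases "n = 0")
    case True
    then show ?thesis using p by (simp add: Psi_nth_0)
  next
    case False
    have "(int p ^ m) ^ n dvd int p ^ repunit p m * (if n = 1 then 1 else 0)"
      using le_repunit[of p m] p by (auto intro: le_imp_power_dvd)
    moreover have "(int p ^ m) ^ n dvd
        int p ^ repunit p m * (int p ^ (j * (n - 1)) * fps_nth (Psi p ^ (p ^ j)) n)" (is "?A dvd ?B")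
      if j: "j \<in> {1..n}" for j
    proof (cases "j \<le> m")
      case True
      have "(int p ^ (m - j)) ^ n dvd (int p ^ repunit p (m - j)) ^ (p ^ j) * fps_nth (Psi p ^ (p ^ j)) n"
        using j True by (intro dvd_fps_nth_power less) simp
      \<comment> \<open>The extra factor makes up for the denominator p^j of the j-th term: as
        \<open>repunit p j \<ge> j\<close>, the exponents add up to
        \<open>repunit p m + j * (n - 1)\<close>.\<close>
      then have "int p ^ (j * n) * (int p ^ (m - j)) ^ n dvd int p ^ (repunit p j - j) *
          (int p ^ (j * n) * ((int p ^ repunit p (m - j)) ^ (p ^ j) * fps_nth (Psi p ^ (p ^ j)) n))"
        by (rule dvd_mult[OF mult_dvd_mono[OF dvd_refl]])
      also have "\<dots> = int p ^ (repunit p j - j + j * n + repunit p (m - j) * p ^ j) * fps_nth (Psi p ^ (p ^ j)) n"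
        by (simp add: power_add mult_ac flip: power_mult)
      also have "repunit p j - j + j * n + repunit p (m - j) * p ^ j = repunit p m + j * (n - 1)"
        using repunit_add[of p j "m - j"] le_repunit[of p j] p True False
        by (cases n) (auto simp: algebra_simps)
      also have "int p ^ (j * n) * (int p ^ (m - j)) ^ n = ?A"
        using True by (simp add: power_mult flip: power_mult_distrib power_add)
      finally show ?thesis
        by (simp add: power_add mult_ac)
    next
      case j_gt: False
      show ?thesis
      proof (cases "n < p ^ j")
        case True
        then show ?thesis using p by (simp add: Psi_power_nth_eq_0)
      next
        case False
        then have n: "j \<le> n"
          using p power_gt_expt[of p j] by simp
        \<comment> \<open>Here \<open>m \<le> j - 1\<close> and \<open>j \<le> n\<close>, so m n
          \<le> (j - 1) n = j n - n \<le> j n - j.\<close>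
        have "m * n + j \<le> (j - 1) * n + n"
          using j_gt n by (intro add_mono mult_right_mono) auto
        also have "\<dots> = j * (n - 1) + j"
          using j by (cases j; cases n) auto
        finally have "m * n \<le> repunit p m + j * (n - 1)"
          by simp
        then have "?A dvd int p ^ (repunit p m + j * (n - 1))"
          by (subst power_mult[symmetric]) (rule le_imp_power_dvd)
        then show ?thesis
          by (simp add: power_add mult.assoc[symmetric])
      qed
    qed
    ultimately show ?thesis
      using False p
      by (subst Psi_nth) (auto simp: right_diff_distrib sum_distrib_left intro!: dvd_diff dvd_sum)
  qed
qed

text \<open>The coefficient of T^n in the functional equation. Terms with j > n start in degree
  above n, so every cutoff K > n gives the same sum.\<close>

lemma Psi_power_sum:
  assumes p: "p > 1" and "n > 0" "n < K"
  shows "(\<Sum>j<K. int p ^ (j * (n - 1)) * fps_nth (Psi p ^ (p ^ j)) n) = (if n = 1 then 1 else 0)"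
proof -
  let ?t = "\<lambda>j. int p ^ (j * (n - 1)) * fps_nth (Psi p ^ (p ^ j)) n"
  have "?t j = 0" if "j > n" for j
    using that p power_gt_expt[of p j] by (simp add: Psi_power_nth_eq_0)
  then have "sum ?t {..<K} = sum ?t {..n}"
    using assms(3) by (intro sum.mono_neutral_right) auto
  also have "{..n} = insert 0 {1..n}" by auto
  also have "sum ?t \<dots> = ?t 0 + sum ?t {1..n}" by simp
  also have "\<dots> = (if n = 1 then 1 else 0)"
    using Psi_nth[OF p assms(2)] by simp
  finally show ?thesis .
qed

lemma dvd_power_prime_minus:
  fixes a :: int
  assumes "prime p"
  shows "int p dvd a ^ p - a"
proof -
  have p: "p > 0" using assms prime_gt_0_nat by blast
  define b where "b = nat (a mod int p)"
  have ab: "[a = int b] (mod int p)"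
    using p by (simp add: b_def cong_def)
  have "[b ^ p = b] (mod p)"
  proof (cases "p dvd b")
    case True
    then show ?thesis using p by (simp add: cong_def dvd_power_le[of p b 1 p, simplified])
  next
    case False
    have "[b ^ (p - 1) * b = 1 * b] (mod p)"
      by (intro cong_mult fermat_theorem assms False cong_refl)
    then show ?thesis using p by (simp add: power_eq_if mult.commute)
  qed
  then have "[int b ^ p = int b] (mod int p)"
    using cong_int_iff[of "b ^ p" b p] by simp
  then have "[a ^ p = a] (mod int p)"
    using ab cong_pow[OF ab, of p] by (meson cong_trans cong_sym)
  then show ?thesis
    by (simp add: cong_iff_dvd_diff)
qed

subsection \<open>Values of \<open>\<Psi>\<close> and the functional equation\<close>

locale padic_Cp_prime = padic_Cp p av for p :: nat and av :: "'a::field_char_0 \<Rightarrow> real" +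
  assumes prime_p: "prime p"
begin

lemma p_gt_1: "p > 1"
  by (rule prime_gt_1_nat[OF prime_p])

section \<open>p-adic absolute values of integers\<close>

lemma av_of_int:
  assumes "k \<noteq> 0"
  shows "av (of_int k) = 1 / real p ^ multiplicity (int p) k"
proof -
  have "av (of_int k) = padic_abs p (of_int k)"
    using av_of_rat[of "of_int k"] by simp
  also have "\<dots> = real p powi (- int (multiplicity (int p) k))"
    using assms quotient_of_int[of k] by (simp add: padic_abs_def)
  finally show ?thesis
    by (simp add: power_int_minus inverse_eq_divide)
qed

lemma prime_int_p: "prime (int p)"
  using prime_p by simp

lemma av_p: "av (of_nat p) = 1 / real p"
  using av_of_int[of "int p"] p_gt_1 prime_int_p by simp

lemma av_p_power: "av (of_nat p ^ n) = 1 / real p ^ n"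
  by (simp add: av_power av_p power_divide)

lemma av_of_int_le:
  assumes "int p ^ n dvd k"
  shows "av (of_int k) \<le> 1 / real p ^ n"
proof -
  obtain l where "k = int p ^ n * l" using assms by blast
  then have "av (of_int k) = 1 / real p ^ n * av (of_int l)"
    by (simp add: av_mult av_p_power)
  also have "\<dots> \<le> 1 / real p ^ n * 1"
    by (intro mult_left_mono av_of_int_le_1) simp
  finally show ?thesis by simp
qed

lemma av_of_int_unit: "\<not> int p dvd k \<Longrightarrow> av (of_int k) = 1"
  by (cases "k = 0") (auto simp: av_of_int not_dvd_imp_multiplicity_0)

text \<open>A nonzero integer smaller than p^n is not divisible by p^n. This later separates the
  cosets of the fractions i/p^k modulo Z_p.\<close>

lemma av_of_int_gt:
  assumes "k \<noteq> 0" "\<bar>k\<bar> < int p ^ n"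
  shows "1 < av (of_int k) * real p ^ n"
proof -
  have "\<not> int p ^ n dvd k"
    using assms dvd_imp_le_int[of k "int p ^ n"] by auto
  then have "multiplicity (int p) k < n"
    using assms(1) prime_int_p by (intro multiplicity_lessI) auto
  then have "real p ^ multiplicity (int p) k < real p ^ n"
    using p_gt_1 by (intro power_strict_increasing) auto
  then show ?thesis
    using p_gt_1 assms(1) by (simp add: av_of_int field_simps)
qed

lemma obtain_power_bound:
  obtains m where "av x \<le> real p ^ m"
  using real_arch_pow[of "real p" "av x"] p_gt_1 less_imp_le by auto

lemma av_p_power_mult_le:
  assumes "av x \<le> real p ^ m" "m \<le> j"
  shows "av (of_nat p ^ j * x) \<le> 1"
proof -
  have "av x \<le> real p ^ j"
    by (rule order_trans[OF assms(1)]) (use assms(2) p_gt_1 in simp)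
  then show ?thesis
    using p_gt_1 by (simp add: av_mult av_p_power field_simps)
qed

section \<open>\<Psi> as a p-adic entire function\<close>

abbreviation Psi_av :: "'a fps" where
  "Psi_av \<equiv> map_int_fps (Psi p)"

lemma nth_map_int_fps: "fps_nth (map_int_fps F) n = of_int (fps_nth F n)"
  by (simp add: map_int_fps_def)

text \<open>This is \<open>Psi_nth_dvd\<close> in terms of absolute values. As m is arbitrary,
  \<Psi> converges everywhere.\<close>

lemma gauss_le_Psi: "gauss_le Psi_av (real p ^ m) (real p ^ repunit p m)"
  unfolding gauss_le_def nth_map_int_fps
proof
  fix n
  have "int p ^ (m * n) dvd int p ^ repunit p m * fps_nth (Psi p) n"
    using Psi_nth_dvd[OF p_gt_1, of m n] by (simp add: power_mult)
  then have "av (of_int (int p ^ repunit p m * fps_nth (Psi p) n)) \<le> 1 / real p ^ (m * n)"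
    by (rule av_of_int_le)
  then show "av (of_int (fps_nth (Psi p) n)) * (real p ^ m) ^ n \<le> real p ^ repunit p m"
    using p_gt_1 by (simp add: av_mult av_p_power power_mult field_simps)
qed

definition psi :: "'a \<Rightarrow> 'a" where
  "psi x = (THE v. fps_has_value av Psi_av x v)"

lemma gauss_le_imp_value:
  assumes "gauss_le F r B" "av x < r"
  obtains v where "fps_has_value av F x v"
proof -
  have "(\<lambda>n. av (fps_nth F n * x ^ n)) \<longlonglongrightarrow> 0"
    using gauss_le_term_tendsto[OF assms] by (simp add: conv_def)
  then show ?thesis
    using partial_sums_conv[OF complete] that unfolding fps_has_value_iff_conv by metis
qed

lemma obtain_strict_power_bound:
  obtains m where "av x < real p ^ m"
  using real_arch_pow[of "real p" "av x"] p_gt_1 by auto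

lemma has_value_psi: "fps_has_value av Psi_av x (psi x)"
proof -
  obtain m where "av x < real p ^ m" by (rule obtain_strict_power_bound)
  from gauss_le_imp_value[OF gauss_le_Psi this]
  obtain v where v: "fps_has_value av Psi_av x v" .
  then have "psi x = v"
    unfolding psi_def fps_has_value_iff_conv by (rule the_equality) (rule conv_unique[OF _ v[unfolded fps_has_value_iff_conv]])
  with v show ?thesis by simp
qed

lemma fps_zero_iff_psi: "fps_zero av Psi_av x \<longleftrightarrow> psi x = 0"
  using has_value_psi[of x] conv_unique unfolding fps_zero_def fps_has_value_iff_conv by metis

lemma psi_power_value: "fps_has_value av (map_int_fps (Psi p ^ k)) x (psi x ^ k)"
proof -
  obtain m where "av x < real p ^ m" by (rule obtain_strict_power_bound)
  then show ?thesis
    using fps_has_value_power[OF gauss_le_Psi has_value_psi] by (simp add: map_int_fps_power)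
qed

text \<open>The formal identity is an infinite sum of infinite series and cannot simply be evaluated
  termwise. Instead the J-th partial sum minus T is estimated by coefficients: it vanishes below
  degree p^J, and from there on its terms at x are at most p^(-J) once |x| \<le> p^(J-1).\<close>

lemma functional_equation:
  "conv (\<lambda>J. \<Sum>j<J. psi (of_nat p ^ j * x) ^ (p ^ j) / of_nat p ^ j) x"
proof -
  obtain m where m: "av x \<le> real p ^ m" by (rule obtain_power_bound)
  have "conv (\<lambda>J. (\<Sum>j<J. psi (of_nat p ^ j * x) ^ (p ^ j) / of_nat p ^ j) - x) 0"
  proof (rule conv_null_eventuallyI)
    show "(\<lambda>J. (1 / real p) ^ J) \<longlonglongrightarrow> 0"
      using p_gt_1 by (intro LIMSEQ_power_zero) simp
    show "\<forall>\<^sub>F J in sequentially.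
        av ((\<Sum>j<J. psi (of_nat p ^ j * x) ^ (p ^ j) / of_nat p ^ j) - x) \<le> (1 / real p) ^ J"
      using eventually_gt_at_top[of m]
    proof eventually_elim
      case (elim J)
      define c where "c j n = fps_nth (Psi p ^ (p ^ j)) n" for j n
      \<comment> \<open>The coefficient of T^n in the J-th partial sum of the functional equation
        minus T.\<close>
      define D where "D n = (\<Sum>j<J. int p ^ (j * (n - 1)) * c j n) - (if n = 1 then 1 else 0)" for n
      have two_J: "2 * J \<le> p ^ J"
      proof -
        have "2 * k \<le> 2 ^ k" if "k > 0" for k :: nat
          using that by (induction k rule: nat_induct_non_zero) auto
        from this[of J] elim have "2 * J \<le> 2 ^ J" by simp
        also have "\<dots> \<le> p ^ J" using p_gt_1 by (intro power_mono) auto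
        finally show ?thesis .
      qed
      \<comment> \<open>By \<open>Psi_power_sum\<close> the sum over all relevant j is known, so
        \<open>D n\<close> is minus the terms from J on; \<open>J + Suc n\<close> is a cutoff beyond
        both J and n.\<close>
      have D_eq: "D n = - (\<Sum>j\<in>{J..<J + Suc n}. int p ^ (j * (n - 1)) * c j n)" if "n > 0" for n
        using Psi_power_sum[OF p_gt_1 that, of "J + Suc n"]
          sum_diff_nat_ivl[of 0 J "J + Suc n" "\<lambda>j. int p ^ (j * (n - 1)) * c j n"]
        by (simp add: D_def c_def atLeast0LessThan)
      have term_le: "av (of_int (D n) * x ^ n) \<le> (1 / real p) ^ J" if "n > 0" for n
      proof (cases "n < p ^ J")
        case True
        have "c j n = 0" if "j \<in> {J..<J + Suc n}" for j
        proof -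
          have "n < p ^ j"
            by (rule less_le_trans[OF True]) (use that p_gt_1 in simp)
          then show ?thesis
            by (simp add: c_def Psi_power_nth_eq_0[OF p_gt_1])
        qed
        then have "D n = 0"
          unfolding D_eq[OF that] by (simp add: sum.neutral)
        then show ?thesis by simp
      next
        case False
        have "int p ^ (J * (n - 1)) dvd D n"
          unfolding D_eq[OF that]
          by (intro dvd_sum dvd_mult2 le_imp_power_dvd mult_right_mono iffD2[OF dvd_minus_iff]) auto
        then have 1: "av (of_int (D n)) \<le> 1 / real p ^ (J * (n - 1))"
          by (rule av_of_int_le)
        have "av x \<le> real p ^ (J - 1)"
          by (rule order_trans[OF m]) (use elim p_gt_1 in simp)
        then have "av (x ^ n) \<le> (real p ^ (J - 1)) ^ n"
          unfolding av_power by (intro power_mono av_nonneg)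
        then have "av (of_int (D n) * x ^ n) \<le> 1 / real p ^ (J * (n - 1)) * real p ^ ((J - 1) * n)"
          unfolding av_mult using 1 by (intro mult_mono) (auto simp: av_nonneg power_mult)
        also have "\<dots> \<le> (1 / real p) ^ J"
        proof -
          \<comment> \<open>The exponents have to satisfy (J - 1) n + J \<le> J (n - 1), that is 2 J
            \<le> n, which holds as n \<ge> p^J \<ge> 2 J.\<close>
          have "(J - 1) * n + J + n = J * n + J"
            using elim by (cases J) auto
          moreover have "J * n = J * (n - 1) + J"
            using that by (cases n) auto
          moreover have "2 * J \<le> n" using False two_J by simp
          ultimately have "(J - 1) * n + J \<le> J * (n - 1)" by linarith
          then have "real p ^ ((J - 1) * n + J) \<le> real p ^ (J * (n - 1))"
            using p_gt_1 by (intro power_increasing) auto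
          then show ?thesis
            using p_gt_1 by (simp add: power_add field_simps power_divide)
        qed
        finally show ?thesis .
      qed
      let ?P = "\<lambda>j N. \<Sum>n<N. fps_nth (map_int_fps (Psi p ^ (p ^ j))) n * (of_nat p ^ j * x) ^ n"
      have "conv (\<lambda>N. (\<Sum>j<J. 1 / of_nat p ^ j * ?P j N) - x)
          ((\<Sum>j<J. 1 / of_nat p ^ j * psi (of_nat p ^ j * x) ^ (p ^ j)) - x)"
        using psi_power_value unfolding fps_has_value_iff_conv
        by (intro conv_diff conv_sum conv_cmult conv_const)
      moreover have "\<forall>\<^sub>F N in sequentially.
          av ((\<Sum>j<J. 1 / of_nat p ^ j * ?P j N) - x) \<le> (1 / real p) ^ J"
        \<comment> \<open>From N = 2 on the partial sums include degree 1, whose contribution x is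
          cancelled.\<close>
        using eventually_ge_at_top[of 2]
      proof eventually_elim
        case (elim N)
        have coeff: "(\<Sum>j<J. 1 / of_nat p ^ j * (of_int (c j n) * (of_nat p ^ j * x) ^ n)) =
            of_int (D n) * x ^ n + (if n = 1 then x else 0)" for n
        proof (cases n)
          case 0
          have "c j 0 = 0" for j
            using Psi_power_nth_eq_0[OF p_gt_1, of 0 j] p_gt_1 by (simp add: c_def)
          then show ?thesis using 0 by (simp add: D_def)
        next
          case (Suc k)
          have "1 / of_nat p ^ j * (of_int (c j n) * (of_nat p ^ j * x) ^ n) =
              of_int (int p ^ (j * (n - 1)) * c j n) * x ^ n" for j
            using Suc p_gt_1 by (simp add: power_mult_distrib power_mult field_simps)
          then have "(\<Sum>j<J. 1 / of_nat p ^ j * (of_int (c j n) * (of_nat p ^ j * x) ^ n)) =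
              of_int (\<Sum>j<J. int p ^ (j * (n - 1)) * c j n) * x ^ n"
            by (simp add: sum_distrib_right)
          then show ?thesis
            by (simp add: D_def algebra_simps)
        qed
        have "(\<Sum>j<J. 1 / of_nat p ^ j * ?P j N) =
            (\<Sum>n<N. \<Sum>j<J. 1 / of_nat p ^ j * (of_int (c j n) * (of_nat p ^ j * x) ^ n))"
          by (simp only: nth_map_int_fps c_def sum_distrib_left) (rule sum.swap)
        also have "\<dots> = (\<Sum>n<N. of_int (D n) * x ^ n) + x"
          using elim by (simp only: coeff sum.distrib) simp
        finally have "(\<Sum>j<J. 1 / of_nat p ^ j * ?P j N) - x = (\<Sum>n<N. of_int (D n) * x ^ n)"
          by simp
        also have "av \<dots> \<le> (1 / real p) ^ J"
        proof (rule av_sum_le)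
          show "av (of_int (D n) * x ^ n) \<le> (1 / real p) ^ J" for n
          proof (cases "n = 0")
            case True
            then show ?thesis
              using coeff[of 0] Psi_power_nth_eq_0[OF p_gt_1, of 0] p_gt_1 by (simp add: c_def)
          qed (use term_le in simp)
        qed simp
        finally show ?case .
      qed
      ultimately show ?case
        using av_le_of_conv by simp
    qed
  qed
  then show ?thesis
    by (subst conv_iff_diff)
qed


subsection \<open>\<open>\<Psi>\<close> on the field of p-adic numbers\<close>

text \<open>Closure points in a metric space are limits of sequences, so the closure of Q_p under
  ring operations is inherited from the rationals.\<close>

lemma Qp_iff_conv: "x \<in> Qp av \<longleftrightarrow> (\<exists>q. conv (\<lambda>n. of_rat (q n)) x)"
proof -
  have "(\<exists>s. range s \<subseteq> range of_rat \<and> conv s x) \<longleftrightarrow> (\<exists>q. conv (\<lambda>n. of_rat (q n)) x)"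
  proof
    assume "\<exists>s. range s \<subseteq> range of_rat \<and> conv s x"
    then obtain s where s: "range s \<subseteq> range of_rat" "conv s x" by (elim exE conjE)
    have "\<exists>q. s n = of_rat q" for n
      using s(1) by (auto simp: image_iff subset_iff)
    then obtain q where "s n = of_rat (q n)" for n
      by metis
    then have "s = (\<lambda>n. of_rat (q n))" by (rule ext)
    with s(2) have "conv (\<lambda>n. of_rat (q n)) x" by simp
    then show "\<exists>q. conv (\<lambda>n. of_rat (q n)) x" by (rule exI[of _ q])
  next
    assume "\<exists>q. conv (\<lambda>n. of_rat (q n)) x"
    then obtain q where "conv (\<lambda>n. of_rat (q n)) x" by (elim exE)
    then show "\<exists>s. range s \<subseteq> range of_rat \<and> conv s x"
      by (intro exI[of _ "\<lambda>n. of_rat (q n)"] conjI) auto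
  qed
  then show ?thesis
    unfolding Qp_def closure_of_sequentially limitin_iff_conv by simp
qed

lemma Qp_of_rat: "of_rat q \<in> Qp av"
  unfolding Qp_iff_conv by (rule exI[of _ "\<lambda>_. q"]) (rule conv_const)

lemma Qp_of_nat: "of_nat n \<in> Qp av"
  using Qp_of_rat[of "of_nat n"] by simp

lemma Qp_of_int: "of_int n \<in> Qp av"
  using Qp_of_rat[of "of_int n"] by simp

lemma Qp_add: "x \<in> Qp av \<Longrightarrow> y \<in> Qp av \<Longrightarrow> x + y \<in> Qp av"
  unfolding Qp_iff_conv
proof (elim exE)
  fix q r :: "nat \<Rightarrow> rat"
  assume "conv (\<lambda>n. of_rat (q n)) x" "conv (\<lambda>n. of_rat (r n)) y"
  then have "conv (\<lambda>n. of_rat (q n + r n)) (x + y)"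
    unfolding of_rat_add by (rule conv_add)
  then show "\<exists>s. conv (\<lambda>n. of_rat (s n)) (x + y)"
    by (rule exI[of _ "\<lambda>n. q n + r n"])
qed

lemma Qp_mult: "x \<in> Qp av \<Longrightarrow> y \<in> Qp av \<Longrightarrow> x * y \<in> Qp av"
  unfolding Qp_iff_conv
proof (elim exE)
  fix q r :: "nat \<Rightarrow> rat"
  assume "conv (\<lambda>n. of_rat (q n)) x" "conv (\<lambda>n. of_rat (r n)) y"
  then have "conv (\<lambda>n. of_rat (q n * r n)) (x * y)"
    unfolding of_rat_mult by (rule conv_mult)
  then show "\<exists>s. conv (\<lambda>n. of_rat (s n)) (x * y)"
    by (rule exI[of _ "\<lambda>n. q n * r n"])
qed

lemma Qp_diff: "x \<in> Qp av \<Longrightarrow> y \<in> Qp av \<Longrightarrow> x - y \<in> Qp av"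
  using Qp_add[of x "of_int (- 1) * y"] Qp_mult[OF Qp_of_int[of "- 1"], of y] by simp

lemma Qp_sum: "(\<And>i. i \<in> A \<Longrightarrow> f i \<in> Qp av) \<Longrightarrow> (\<Sum>i\<in>A. f i) \<in> Qp av"
  using Qp_of_int[of 0] by (induction A rule: infinite_finite_induct) (simp_all add: Qp_add)

lemma Qp_power: "x \<in> Qp av \<Longrightarrow> x ^ n \<in> Qp av"
  using Qp_of_int[of 1] by (induction n) (simp_all add: Qp_mult)

lemma Qp_conv: "conv s x \<Longrightarrow> (\<And>n. s n \<in> Qp av) \<Longrightarrow> x \<in> Qp av"
  unfolding limitin_iff_conv[symmetric] Qp_def
  by (rule limitin_closedin[OF _ closedin_closure_of]) auto

lemma psi_in_Qp:
  assumes "x \<in> Qp av"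
  shows "psi x \<in> Qp av"
proof (rule Qp_conv)
  show "conv (\<lambda>N. \<Sum>n<N. fps_nth Psi_av n * x ^ n) (psi x)"
    using has_value_psi by (simp add: fps_has_value_iff_conv)
  show "(\<Sum>n<N. fps_nth Psi_av n * x ^ n) \<in> Qp av" for N
    unfolding nth_map_int_fps by (intro Qp_sum Qp_mult Qp_power Qp_of_int assms)
qed

text \<open>Fermat's little theorem on Z_p, by density: a rational a/b in lowest terms close to x
  has b prime to p, and for it the claim reduces to a^p \<equiv> a and b^p \<equiv> b modulo
  p.\<close>

lemma av_power_minus_self_le:
  assumes "x \<in> Qp av" "av x \<le> 1"
  shows "av (x ^ p - x) \<le> 1 / real p"
proof -
  obtain q where "conv (\<lambda>n. of_rat (q n)) x" using assms(1) Qp_iff_conv by blast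
  then have "\<forall>\<^sub>F n in sequentially. av (of_rat (q n) - x) < 1 / real p"
    using p_gt_1 by (auto simp: conv_def dest!: order_tendstoD(2)[where a = "1 / real p"])
  then obtain r where r: "av (of_rat r - x) < 1 / real p"
    using eventually_happens by fastforce
  have small: "1 / real p \<le> 1" using p_gt_1 by simp
  obtain a b where ab: "quotient_of r = (a, b)" by fastforce
  have b: "b > 0" "coprime a b" "r = of_int a / of_int b"
    using quotient_of_denom_pos[OF ab] quotient_of_coprime[OF ab] quotient_of_div[OF ab] by auto
  have rab: "of_rat r = (of_int a / of_int b :: 'a)"
    using b(1) by (simp add: b(3) of_rat_divide)
  have "av (of_rat r) \<le> 1"
    using av_add_le[of "of_rat r - x" 1 x] r small assms(2) by simp
  have "\<not> int p dvd b"
  proof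
    assume "int p dvd b"
    then have le: "av (of_int b) \<le> 1 / real p" and "\<not> int p dvd a"
      using av_of_int_le[of 1 b] b(2) coprime_common_divisor[of a b "int p"] p_gt_1 by auto
    moreover have "av (of_int b) < 1"
      by (rule le_less_trans[OF le]) (use p_gt_1 in simp)
    moreover have "av (of_int b) > 0"
      using b(1) av_eq_0_iff[of "of_int b"] av_nonneg[of "of_int b"] by (simp add: less_le)
    ultimately have "av (of_rat r) > 1"
      by (simp add: rab av_divide av_of_int_unit)
    with \<open>av (of_rat r) \<le> 1\<close> show False by simp
  qed
  then have avb: "av (of_int b) = 1" by (rule av_of_int_unit)
  have "(of_rat r ^ p - of_rat r :: 'a) =
      of_int ((a ^ p - a) * b - a * (b ^ p - b)) / of_int b ^ Suc p"
    using b(1) by (simp add: rab power_divide field_simps)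
  then have "av (of_rat r ^ p - of_rat r) = av (of_int ((a ^ p - a) * b - a * (b ^ p - b)))"
    by (simp only: av_divide av_power avb) simp
  also have "\<dots> \<le> 1 / real p"
    using dvd_power_prime_minus[OF prime_p] by (intro av_of_int_le[of 1, simplified] dvd_diff) simp_all
  finally have 1: "av (of_rat r ^ p - of_rat r) \<le> 1 / real p" .
  have "av (x ^ p - of_rat r ^ p) \<le> av (x - of_rat r)"
    by (rule av_power_diff_le) fact+
  then have 2: "av (x ^ p - of_rat r ^ p) \<le> 1 / real p"
    using r by (simp add: av_diff_commute)
  have "x ^ p - x = (x ^ p - of_rat r ^ p) + (of_rat r ^ p - of_rat r) + (of_rat r - x)"
    by simp
  also have "av \<dots> \<le> 1 / real p"
    using 1 2 r by (intro av_add_le) auto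
  finally show ?thesis .
qed

text \<open>Factor x^p - y^p as x - y times a sum of p terms; for x \<equiv> y modulo p this sum is
  congruent to p y^(p-1), hence divisible by p.\<close>

lemma av_power_p_diff_le:
  assumes "av x \<le> 1" "av y \<le> 1" "av (x - y) \<le> 1 / real p"
  shows "av (x ^ p - y ^ p) \<le> av (x - y) / real p"
proof -
  have "(\<Sum>i<p. y ^ (p - Suc i) * x ^ i) =
      (\<Sum>i<p. y ^ (p - Suc i) * (x ^ i - y ^ i)) + of_nat p * y ^ (p - 1)"
  proof -
    have "y ^ (p - Suc i) * x ^ i = y ^ (p - Suc i) * (x ^ i - y ^ i) + y ^ (p - 1)" if "i < p" for i
      using that by (simp add: right_diff_distrib flip: power_add)
    then show ?thesis
      by (simp add: sum.distrib)
  qed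
  also have "av \<dots> \<le> 1 / real p"
  proof (intro av_add_le av_sum_le)
    fix i
    have "av (y ^ (p - Suc i)) * av (x ^ i - y ^ i) \<le> 1 * (1 / real p)"
      using assms(2) order_trans[OF av_power_diff_le[OF assms(1,2)] assms(3)]
      by (intro mult_mono) (auto simp: av_power av_nonneg power_le_one)
    then show "av (y ^ (p - Suc i) * (x ^ i - y ^ i)) \<le> 1 / real p"
      by (simp add: av_mult)
    show "av (of_nat p * y ^ (p - 1)) \<le> 1 / real p"
      using assms(2) by (simp add: av_mult av_p av_power av_nonneg power_le_one divide_right_mono)
  qed simp
  finally have "av (\<Sum>i<p. y ^ (p - Suc i) * x ^ i) \<le> 1 / real p" .
  then have "av (x - y) * av (\<Sum>i<p. y ^ (p - Suc i) * x ^ i) \<le> av (x - y) * (1 / real p)"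
    by (intro mult_left_mono av_nonneg)
  then show ?thesis
    by (simp add: power_diff_sumr2 av_mult)
qed

text \<open>Each p-th power gains a factor 1/p. The total gain p^(-j) is what cancels the
  denominators p^j in the functional equation.\<close>

lemma av_power_p_power_diff_le:
  assumes "av x \<le> 1" "av y \<le> 1" "av (x - y) \<le> 1 / real p"
  shows "av (x ^ (p ^ j) - y ^ (p ^ j)) \<le> av (x - y) / real p ^ j"
proof (induction j)
  case (Suc j)
  have "av (x - y) / real p ^ j \<le> av (x - y) / 1"
    using p_gt_1 by (intro divide_left_mono) (auto simp: av_nonneg)
  then have "av (x ^ (p ^ j) - y ^ (p ^ j)) \<le> 1 / real p"
    using Suc assms(3) by simp
  then have "av ((x ^ (p ^ j)) ^ p - (y ^ (p ^ j)) ^ p) \<le> av (x ^ (p ^ j) - y ^ (p ^ j)) / real p"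
    using assms by (intro av_power_p_diff_le) (auto simp: av_power av_nonneg power_le_one)
  also have "\<dots> \<le> av (x - y) / real p ^ j / real p"
    using Suc by (intro divide_right_mono) auto
  finally show ?case
    by (simp add: mult.commute flip: power_mult)
qed simp

text \<open>Isolates the term j = 0. The remaining terms involve \<Psi> only at p x, p^2 x, ...,
  which lie in smaller discs; this allows induction on the size of x.\<close>

lemma functional_equation_tail:
  "conv (\<lambda>J. \<Sum>j<J. psi (of_nat p ^ Suc j * x) ^ (p ^ Suc j) / of_nat p ^ Suc j) (x - psi x)"
proof -
  have "conv (\<lambda>J. (\<Sum>j<Suc J. psi (of_nat p ^ j * x) ^ (p ^ j) / of_nat p ^ j) - psi x) (x - psi x)"
    using functional_equation[of x] conv_Suc_iff[of "\<lambda>J. \<Sum>j<J. psi (of_nat p ^ j * x) ^ (p ^ j) / of_nat p ^ j"]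
    by (intro conv_diff conv_const) blast
  then show ?thesis
    unfolding sum.lessThan_Suc_shift by simp
qed

text \<open>Subtract the functional equation at \<open>x\<close> from \<open>1 / p\<close> times the one at \<open>p x\<close>, which expands
  the same \<open>x\<close> with the exponents lowered by one; the terms differ by integral elements by
  Fermat's little theorem.\<close>

lemma av_psi_le_1:
  assumes "x \<in> Qp av"
  shows "av (psi x) \<le> 1"
proof -
  \<comment> \<open>Induction on a bound p^m for |y|. On the unit disc integral coefficients
    suffice; in the step the points p^(j+1) y lie in the disc of the induction hypothesis.\<close>
  have "av (psi y) \<le> 1" if "y \<in> Qp av" "av y \<le> real p ^ m" for m y
    using that
  proof (induction m arbitrary: y)
    case 0
    have "conv (\<lambda>N. \<Sum>n<N. fps_nth Psi_av n * y ^ n) (psi y)"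
      using has_value_psi by (simp add: fps_has_value_iff_conv)
    moreover have "av (\<Sum>n<N. fps_nth Psi_av n * y ^ n) \<le> 1" for N
      using 0 by (intro av_sum_le)
        (auto simp: nth_map_int_fps av_mult av_power av_nonneg av_of_int_le_1 intro!: mult_le_one power_le_one)
    ultimately show ?case
      by (auto intro: av_le_of_conv)
  next
    case (Suc m)
    define b where "b j = psi (of_nat p ^ Suc j * y)" for j
    have b: "b j \<in> Qp av" "av (b j) \<le> 1" for j
    proof -
      have *: "of_nat p ^ Suc j * y \<in> Qp av"
        by (intro Qp_mult Qp_power Qp_of_nat Suc.prems)
      then show "b j \<in> Qp av" unfolding b_def by (rule psi_in_Qp)
      have "av (of_nat p ^ Suc j * y) = av y / real p * (1 / real p ^ j)"
        by (simp add: av_mult av_p_power av_p)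
      also have "\<dots> \<le> real p ^ m * 1"
        using Suc.prems p_gt_1 by (intro mult_mono) (auto simp: field_simps)
      finally show "av (b j) \<le> 1"
        unfolding b_def using * by (intro Suc.IH) auto
    qed
    have "conv (\<lambda>J. 1 / of_nat p * (\<Sum>j<J. psi (of_nat p ^ j * (of_nat p * y)) ^ (p ^ j) / of_nat p ^ j))
        (1 / of_nat p * (of_nat p * y))"
      by (intro conv_cmult functional_equation)
    then have "conv (\<lambda>J. \<Sum>j<J. b j ^ (p ^ j) / of_nat p ^ Suc j) y"
      using p_gt_1 by (simp add: b_def sum_distrib_left mult_ac)
    from conv_diff[OF this functional_equation_tail[of y]]
    have "conv (\<lambda>J. \<Sum>j<J. (b j ^ (p ^ j) - b j ^ (p ^ Suc j)) / of_nat p ^ Suc j) (psi y)"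
      by (simp add: b_def sum_subtractf diff_divide_distrib)
    moreover have "av (\<Sum>j<J. (b j ^ (p ^ j) - b j ^ (p ^ Suc j)) / of_nat p ^ Suc j) \<le> 1" for J
    proof (rule av_sum_le)
      fix j
      \<comment> \<open>\<open>b j ^ (p ^ Suc j)\<close> is the p^j-th power of
        \<open>b j ^ p\<close>, which is congruent to \<open>b j\<close> modulo p. This congruence
        and the gain p^(-j) together cancel the denominator p^(j+1).\<close>
      have "av ((b j ^ p) ^ (p ^ j) - b j ^ (p ^ j)) \<le> av (b j ^ p - b j) / real p ^ j"
        using b av_power_minus_self_le[OF b]
        by (intro av_power_p_power_diff_le) (auto simp: av_power av_nonneg power_le_one)
      also have "\<dots> \<le> 1 / real p / real p ^ j"
        using av_power_minus_self_le[OF b] by (intro divide_right_mono) auto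
      finally have "av (b j ^ (p ^ j) - b j ^ (p ^ Suc j)) \<le> 1 / real p ^ Suc j"
        by (subst av_diff_commute) (simp add: power_mult)
      then show "av ((b j ^ (p ^ j) - b j ^ (p ^ Suc j)) / of_nat p ^ Suc j) \<le> 1"
        using p_gt_1 by (simp add: av_divide av_mult av_p av_p_power field_simps)
    qed simp
    ultimately show ?case
      by (auto intro: av_le_of_conv)
  qed
  moreover obtain m where "av x \<le> real p ^ m" by (rule obtain_power_bound)
  ultimately show ?thesis using assms by blast
qed

text \<open>Compare the functional equations at x and y. For j \<ge> 1 the distance of p^j x and p^j
  y has the additional factor p^(-j), and the p^j-th powers cancel the denominators. The Lipschitz
  bound at these points is a hypothesis, so that it can come first from an induction and later from
  \<open>psi_lipschitz\<close>.\<close>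

lemma psi_contraction_step:
  assumes "x \<in> Qp av" "y \<in> Qp av" "av (x - y) \<le> 1"
    and lip: "\<And>j. av (psi (of_nat p ^ Suc j * x) - psi (of_nat p ^ Suc j * y)) \<le>
      av (of_nat p ^ Suc j * x - of_nat p ^ Suc j * y)"
  shows "av ((psi x - psi y) - (x - y)) \<le> av (x - y) / real p"
proof -
  let ?b = "\<lambda>j x. psi (of_nat p ^ Suc j * x)"
  have int: "av (?b j z) \<le> 1" if "z \<in> Qp av" for j z
    by (intro av_psi_le_1 Qp_mult Qp_power Qp_of_nat that)
  from conv_diff[OF functional_equation_tail[of x] functional_equation_tail[of y]]
  have "conv (\<lambda>J. \<Sum>j<J. (?b j x ^ (p ^ Suc j) - ?b j y ^ (p ^ Suc j)) / of_nat p ^ Suc j)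
      ((x - psi x) - (y - psi y))"
    by (simp only: sum_subtractf diff_divide_distrib)
  moreover have "av (\<Sum>j<J. (?b j x ^ (p ^ Suc j) - ?b j y ^ (p ^ Suc j)) / of_nat p ^ Suc j)
      \<le> av (x - y) / real p" for J
  proof (rule av_sum_le)
    fix j
    have "of_nat p ^ Suc j * x - of_nat p ^ Suc j * y = of_nat p ^ Suc j * (x - y)"
      by (simp add: right_diff_distrib)
    with lip[of j] have d: "av (?b j x - ?b j y) \<le> av (x - y) / real p ^ Suc j"
      by (simp only: av_mult av_p_power) simp
    have pj: "real p \<le> real p ^ Suc j" using p_gt_1 by simp
    have "av (x - y) / real p ^ Suc j \<le> av (x - y) / real p"
      using pj p_gt_1 by (intro divide_left_mono) (auto simp: av_nonneg)
    then have d': "av (?b j x - ?b j y) \<le> av (x - y) / real p"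
      using d by linarith
    then have "av (?b j x - ?b j y) \<le> 1 / real p"
      using assms(3) divide_right_mono[of "av (x - y)" 1 "real p"] by simp
    then have "av (?b j x ^ (p ^ Suc j) - ?b j y ^ (p ^ Suc j)) \<le> av (?b j x - ?b j y) / real p ^ Suc j"
      by (intro av_power_p_power_diff_le int assms)
    also have "\<dots> \<le> av (x - y) / real p / real p ^ Suc j"
      using d' by (rule divide_right_mono) simp
    finally show "av ((?b j x ^ (p ^ Suc j) - ?b j y ^ (p ^ Suc j)) / of_nat p ^ Suc j)
        \<le> av (x - y) / real p"
      using p_gt_1 unfolding av_divide av_p_power by (simp add: field_simps)
  qed (simp add: av_nonneg)
  ultimately have "av ((x - psi x) - (y - psi y)) \<le> av (x - y) / real p"
    by (auto intro: av_le_of_conv)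
  then show ?thesis
    using av_minus[of "(x - psi x) - (y - psi y)"] by (simp add: algebra_simps)
qed

text \<open>Induction on the size of x and y. In the unit disc powers are 1-Lipschitz and
  coefficients integral; in the step \<open>psi_contraction_step\<close> bounds
  \<open>(psi x - psi y) - (x - y)\<close>, and the ultrametric inequality removes
  \<open>x - y\<close>.\<close>

lemma psi_lipschitz:
  assumes "x \<in> Qp av" "y \<in> Qp av" "av (x - y) \<le> 1"
  shows "av (psi x - psi y) \<le> av (x - y)"
proof -
  have "av (psi x - psi y) \<le> av (x - y)"
    if "x \<in> Qp av" "y \<in> Qp av" "av (x - y) \<le> 1" "av x \<le> real p ^ m" "av y \<le> real p ^ m" for m x y
    using that
  proof (induction m arbitrary: x y)
    case 0
    have "conv (\<lambda>N. (\<Sum>n<N. fps_nth Psi_av n * x ^ n) - (\<Sum>n<N. fps_nth Psi_av n * y ^ n)) (psi x - psi y)"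
      using has_value_psi by (intro conv_diff) (simp_all add: fps_has_value_iff_conv)
    moreover have "av ((\<Sum>n<N. fps_nth Psi_av n * x ^ n) - (\<Sum>n<N. fps_nth Psi_av n * y ^ n)) \<le> av (x - y)" for N
    proof -
      have "av (fps_nth Psi_av n * (x ^ n - y ^ n)) \<le> 1 * av (x - y)" for n
        unfolding av_mult using 0
        by (intro mult_mono av_power_diff_le) (auto simp: nth_map_int_fps av_of_int_le_1 av_nonneg)
      then have "av (\<Sum>n<N. fps_nth Psi_av n * (x ^ n - y ^ n)) \<le> av (x - y)"
        by (intro av_sum_le) (simp_all add: av_nonneg)
      then show ?thesis
        by (simp add: sum_subtractf right_diff_distrib)
    qed
    ultimately show ?case
      by (auto intro: av_le_of_conv)
  next
    case (Suc m)
    have "av ((psi x - psi y) - (x - y)) \<le> av (x - y) / real p"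
    proof (rule psi_contraction_step)
      fix j
      have le: "av (of_nat p ^ Suc j * z) \<le> B" if "av z \<le> real p * B" "B \<ge> 0" for z B
      proof -
        have "av (of_nat p ^ Suc j * z) = av z / real p * (1 / real p ^ j)"
          by (simp add: av_mult av_p_power av_p)
        also have "\<dots> \<le> B * 1"
          using that p_gt_1 by (intro mult_mono) (auto simp: field_simps)
        finally show ?thesis by simp
      qed
      have "of_nat p ^ Suc j * x - of_nat p ^ Suc j * y = of_nat p ^ Suc j * (x - y)"
        by (simp add: right_diff_distrib)
      moreover have "av (of_nat p ^ Suc j * (x - y)) \<le> 1"
        using Suc.prems p_gt_1 by (intro le) auto
      ultimately have 1: "av (of_nat p ^ Suc j * x - of_nat p ^ Suc j * y) \<le> 1"
        by simp
      show "av (psi (of_nat p ^ Suc j * x) - psi (of_nat p ^ Suc j * y)) \<le>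
          av (of_nat p ^ Suc j * x - of_nat p ^ Suc j * y)"
        using Suc.prems by (intro Suc.IH Qp_mult Qp_power Qp_of_nat 1 le) auto
    qed (use Suc.prems in auto)
    also have "\<dots> \<le> av (x - y)"
      using p_gt_1 divide_left_mono[of 1 "real p" "av (x - y)"] by (simp add: av_nonneg)
    finally show ?case
      using av_add_le[of "(psi x - psi y) - (x - y)" "av (x - y)" "x - y"] by simp
  qed
  moreover obtain m where m: "av x \<le> real p ^ m" by (rule obtain_power_bound)
  obtain k where k: "av y \<le> real p ^ k" by (rule obtain_power_bound)
  have "real p ^ m \<le> real p ^ max m k" "real p ^ k \<le> real p ^ max m k"
    using p_gt_1 by simp_all
  then have "av x \<le> real p ^ max m k" "av y \<le> real p ^ max m k"
    using m k by linarith+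
  ultimately show ?thesis using assms by blast
qed

text \<open>Equivalently, \<open>x - psi x\<close> contracts distances within a coset of Z_p by the
  factor 1/p; it is iterated in \<open>psi_zero_exists\<close>.\<close>

lemma psi_contraction:
  assumes "x \<in> Qp av" "y \<in> Qp av" "av (x - y) \<le> 1"
  shows "av ((psi x - psi y) - (x - y)) \<le> av (x - y) / real p"
proof (rule psi_contraction_step[OF assms])
  fix j
  have "of_nat p ^ Suc j * x - of_nat p ^ Suc j * y = of_nat p ^ Suc j * (x - y)"
    by (simp add: right_diff_distrib)
  moreover have "av (of_nat p ^ Suc j * (x - y)) \<le> 1"
    by (rule av_p_power_mult_le[of _ 0]) (use assms(3) in simp_all)
  ultimately show "av (psi (of_nat p ^ Suc j * x) - psi (of_nat p ^ Suc j * y)) \<le>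
      av (of_nat p ^ Suc j * x - of_nat p ^ Suc j * y)"
    by (intro psi_lipschitz Qp_mult Qp_power Qp_of_nat assms) simp
qed

text \<open>Iterates \<open>x - psi x\<close> from a. Every step moves by an integral element, so
  the iterates stay in a + Z_p, and their limit is a zero.\<close>

lemma psi_zero_exists:
  assumes "a \<in> Qp av"
  obtains z where "z \<in> Qp av" "av (z - a) \<le> 1" "psi z = 0"
proof -
  define s where "s n = ((\<lambda>x. x - psi x) ^^ n) a" for n
  have s_Suc: "s (Suc n) = s n - psi (s n)" for n by (simp add: s_def)
  have s_Qp: "s n \<in> Qp av" for n
  proof (induction n)
    case (Suc n)
    then show ?case unfolding s_Suc by (intro Qp_diff psi_in_Qp)
  qed (simp add: s_def assms)
  have psi_s: "av (psi (s n)) \<le> (1 / real p) ^ n" for n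
  proof (induction n)
    case (Suc n)
    have "av (s (Suc n) - s n) = av (psi (s n))"
      by (simp add: s_Suc av_minus)
    \<comment> \<open>Since \<open>s (Suc n) - s n\<close> is \<open>- psi (s n)\<close>, the
      contraction estimate bounds \<open>psi (s (Suc n))\<close> itself.\<close>
    moreover have "av ((psi (s (Suc n)) - psi (s n)) - (s (Suc n) - s n)) \<le> av (s (Suc n) - s n) / real p"
      using calculation av_psi_le_1[OF s_Qp] by (intro psi_contraction s_Qp) simp
    moreover have "(psi (s (Suc n)) - psi (s n)) - (s (Suc n) - s n) = psi (s (Suc n))"
      by (simp add: s_Suc)
    ultimately have "av (psi (s (Suc n))) \<le> av (psi (s n)) / real p"
      by simp
    also have "\<dots> \<le> (1 / real p) ^ n / real p"
      using Suc by (rule divide_right_mono) simp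
    finally show ?case by simp
  qed (use av_psi_le_1[OF s_Qp] in simp)
  have lim0: "(\<lambda>n. (1 / real p) ^ n) \<longlonglongrightarrow> 0"
    using p_gt_1 by (intro LIMSEQ_power_zero) simp
  have null: "conv (\<lambda>n. psi (s n)) 0"
    using lim0 psi_s by (rule conv_nullI)
  have "(\<lambda>n. av (- psi (s n))) \<longlonglongrightarrow> 0"
    using null by (simp add: conv_def av_minus)
  then obtain v where v: "conv (\<lambda>N. \<Sum>n<N. - psi (s n)) v"
    using partial_sums_conv[OF complete] by metis
  have partial: "s N = a + (\<Sum>n<N. - psi (s n))" for N
  proof (induction N)
    case (Suc N)
    then show ?case by (simp add: s_Suc del: sum_negf)
  qed (simp add: s_def)
  define z where "z = a + v"
  have "conv (\<lambda>N. a + (\<Sum>n<N. - psi (s n))) z"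
    unfolding z_def by (intro conv_add conv_const v)
  then have z: "conv s z"
    by (simp only: partial[symmetric])
  have zQ: "z \<in> Qp av" using z s_Qp by (rule Qp_conv)
  have "av (s N - a) \<le> 1" for N
    using av_psi_le_1[OF s_Qp] by (simp add: partial[of N] del: sum_negf) (intro av_sum_le, auto simp: av_minus)
  then have za: "av (z - a) \<le> 1"
    by (intro av_le_of_conv[OF conv_diff[OF z conv_const]]) simp
  have "conv (\<lambda>n. psi (s n) - psi z) 0"
  proof (rule conv_null_eventuallyI)
    show lim: "(\<lambda>n. av (s n - z)) \<longlonglongrightarrow> 0"
      using z by (simp add: conv_def)
    have "\<forall>\<^sub>F n in sequentially. av (s n - z) < 1"
      using order_tendstoD(2)[OF lim, of 1] by simp
    then show "\<forall>\<^sub>F n in sequentially. av (psi (s n) - psi z) \<le> av (s n - z)"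
      by eventually_elim (intro psi_lipschitz s_Qp zQ, simp)
  qed
  then have "conv (\<lambda>n. psi (s n)) (psi z)"
    by (subst conv_iff_diff)
  then have "psi z = 0"
    using null by (rule conv_unique)
  with zQ za that show ?thesis by blast
qed


subsection \<open>Counting zeros\<close>

lemma av_fact_le: "av (of_nat (fact (p ^ k))) \<le> 1 / real p ^ repunit p k"
proof -
  have "int (p ^ repunit p k) dvd int (fact (p ^ k))"
    using prime_power_repunit_dvd_fact[of p k] p_gt_1 by (simp only: int_dvd_int_iff)
  then have "av (of_int (int (fact (p ^ k)))) \<le> 1 / real p ^ repunit p k"
    by (intro av_of_int_le) (simp only: of_nat_power)
  then show ?thesis by (simp only: of_int_of_nat_eq)
qed

section \<open>Counting zeros with multiplicity in the disc of radius p^k\<close>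

context
  fixes k :: nat and z :: "nat \<Rightarrow> 'a"
  assumes z_0: "z 0 = 0"
    and psi_z: "\<And>i. i < p ^ k \<Longrightarrow> psi (z i) = 0"
    and z_near: "\<And>i. i < p ^ k \<Longrightarrow> av (z i - of_nat i / of_nat p ^ k) \<le> 1"
begin

lemma av_of_int_divide_gt:
  assumes "i \<noteq> 0" "\<bar>i\<bar> < int p ^ k"
  shows "av (of_int i / of_nat p ^ k) > 1"
  using av_of_int_gt[OF assms] by (simp add: av_divide av_p_power)

text \<open>For 0 < i < p^k the fraction i/p^k lies outside Z_p, so it dominates its integral
  difference from \<open>z i\<close>.\<close>

lemma av_z_le:
  assumes "i \<in> {1..<p ^ k}"
  shows "av (z i) \<le> av (of_nat i) * real p ^ k"
proof -
  have i: "int i \<noteq> 0" "\<bar>int i\<bar> < int p ^ k"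
    using assms by (auto simp flip: of_nat_power)
  have "av (of_nat i / of_nat p ^ k) > 1"
    using av_of_int_divide_gt[OF i] by simp
  then have "av (z i) \<le> av (of_nat i / of_nat p ^ k)"
    using z_near[of i] assms
      av_add_le[of "z i - of_nat i / of_nat p ^ k" "av (of_nat i / of_nat p ^ k)" "of_nat i / of_nat p ^ k"]
    by simp
  then show ?thesis
    by (simp add: av_divide av_p_power)
qed

text \<open>Equal zeros would put i/p^k and j/p^k in the same coset of Z_p, which is impossible for
  distinct indices below p^k.\<close>

lemma inj_on_z: "inj_on z {..<p ^ k}"
proof (rule inj_onI)
  fix i j assume ij: "i \<in> {..<p ^ k}" "j \<in> {..<p ^ k}" "z i = z j"
  have "of_int (int i - int j) / of_nat p ^ k =
      (z j - of_nat j / of_nat p ^ k) - (z i - of_nat i / of_nat p ^ k)"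
    using ij(3) by (simp add: diff_divide_distrib)
  also have "av \<dots> \<le> 1"
    by (rule av_diff_le) (use ij(1,2) z_near in auto)
  finally have "\<not> av (of_int (int i - int j) / of_nat p ^ k) > 1"
    by simp
  moreover have "\<bar>int i - int j\<bar> < int p ^ k"
    using ij by (auto simp flip: of_nat_power)
  ultimately have "int i - int j = 0"
    using av_of_int_divide_gt by blast
  then show "i = j" by simp
qed

lemma av_z_lt:
  assumes "i < p ^ k"
  shows "av (z i) < real p ^ Suc k"
proof (cases "i = 0")
  case True
  then show ?thesis using p_gt_1 by (simp add: z_0)
next
  case False
  then have "av (z i) \<le> av (of_nat i) * real p ^ k"
    using assms by (intro av_z_le) auto
  also have "\<dots> \<le> 1 * real p ^ k"
    by (intro mult_right_mono av_of_nat_le_1) simp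
  also have "\<dots> < real p ^ Suc k"
    using p_gt_1 by simp
  finally show ?thesis .
qed

text \<open>The bounds |i| p^k multiply to |(p^k - 1)!| times a power of p, and |(p^k)!| is at most
  \<open>1 / p ^ repunit p k\<close>.\<close>

lemma prod_av_z_le:
  "(\<Prod>i\<in>{1..<p ^ k}. av (z i)) * real p ^ repunit p k \<le> real p ^ (k * p ^ k)"
proof -
  have pk: "p ^ k = Suc (p ^ k - 1)"
    using p_gt_1 by simp
  have "(\<Prod>i\<in>{1..<p ^ k}. av (z i)) \<le> (\<Prod>i\<in>{1..<p ^ k}. av (of_nat i) * real p ^ k)"
    using av_z_le by (intro prod_mono) (simp add: av_nonneg)
  also have "\<dots> = av (of_nat (fact (p ^ k - 1))) * (real p ^ k) ^ (p ^ k - 1)"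
    by (subst pk) (simp add: prod.distrib fact_prod av_prod atLeastLessThanSuc_atLeastAtMost)
  finally have le: "(\<Prod>i\<in>{1..<p ^ k}. av (z i)) \<le> av (of_nat (fact (p ^ k - 1))) * (real p ^ k) ^ (p ^ k - 1)" .
  \<comment> \<open>Completing the factorial by the factor p^k, of absolute value p^(-k), turns the
    exponent k (p^k - 1) into k p^k.\<close>
  have "(fact (p ^ k) :: nat) = p ^ k * fact (p ^ k - 1)"
    by (subst (1 2) pk) simp
  then have "av (of_nat (fact (p ^ k))) = 1 / real p ^ k * av (of_nat (fact (p ^ k - 1)))"
    by (simp only: of_nat_mult of_nat_power av_mult av_p_power)
  then have "av (of_nat (fact (p ^ k - 1))) = real p ^ k * av (of_nat (fact (p ^ k)))"
    using p_gt_1 by simp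
  also have "\<dots> \<le> real p ^ k * (1 / real p ^ repunit p k)"
    by (intro mult_left_mono av_fact_le) simp
  finally have fact_le: "av (of_nat (fact (p ^ k - 1))) * real p ^ repunit p k \<le> real p ^ k"
    using p_gt_1 by (simp add: field_simps)
  have "(\<Prod>i\<in>{1..<p ^ k}. av (z i)) * real p ^ repunit p k \<le>
      av (of_nat (fact (p ^ k - 1))) * (real p ^ k) ^ (p ^ k - 1) * real p ^ repunit p k"
    using le by (rule mult_right_mono) simp
  also have "\<dots> = (av (of_nat (fact (p ^ k - 1))) * real p ^ repunit p k) * (real p ^ k) ^ (p ^ k - 1)"
    by (simp only: mult_ac)
  also have "\<dots> \<le> real p ^ k * (real p ^ k) ^ (p ^ k - 1)"
    using fact_le by (rule mult_right_mono) simp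
  also have "\<dots> = (real p ^ k) ^ (p ^ k)"
    by (simp only: power_Suc[symmetric] pk[symmetric])
  finally show ?thesis
    by (simp only: power_mult)
qed

text \<open>After division by the factors at y and all \<open>z i\<close>, the coefficient 1 of T in
  \<Psi> becomes -y times the product of the \<open>- z i\<close> for i > 0 times the constant
  coefficient of the quotient. The bounds on these multiply to 1/p. Since y may coincide with some
  \<open>z i\<close>, multiple zeros are covered as well.\<close>

lemma no_further_zero:
  assumes G: "Psi_av = (fps_X - fps_const y) * G"
      "gauss_le G (real p ^ Suc k) (real p ^ repunit p (Suc k) / real p ^ Suc k)"
    and y: "av y \<le> real p ^ k"
    and zeros: "\<And>i. i < p ^ k \<Longrightarrow> fps_zero av G (z i)"
  shows False
proof -
  let ?r = "real p ^ Suc k"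
  have card: "card (z ` {..<p ^ k}) = p ^ k"
    using card_image[OF inj_on_z] by simp
  obtain H where H: "G = (\<Prod>s\<in>z ` {..<p ^ k}. fps_X - fps_const s) * H"
    "gauss_le H ?r (real p ^ repunit p (Suc k) / ?r / ?r ^ card (z ` {..<p ^ k}))"
  proof (rule fps_zeros_division[OF G(2)])
    show "fps_zero av G s \<and> av s < ?r" if "s \<in> z ` {..<p ^ k}" for s
      using that zeros av_z_lt by auto
  qed auto
  \<comment> \<open>\<open>z 0 = 0\<close> contributes the factor T, so that the coefficient of T
    becomes a constant coefficient.\<close>
  have "{..<p ^ k} = insert 0 {1..<p ^ k}"
    using p_gt_1 by auto
  then have "(\<Prod>s\<in>z ` {..<p ^ k}. fps_X - fps_const s) =
      fps_X * (\<Prod>i\<in>{1..<p ^ k}. fps_X - fps_const (z i))"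
    using inj_on_z by (simp add: prod.reindex z_0 o_def)
  then have "Psi_av = fps_X * ((fps_X - fps_const y) * (\<Prod>i\<in>{1..<p ^ k}. fps_X - fps_const (z i)) * H)"
    unfolding G(1) H(1) by (simp only: mult_ac)
  then have "fps_nth Psi_av 1 =
      fps_nth ((fps_X - fps_const y) * (\<Prod>i\<in>{1..<p ^ k}. fps_X - fps_const (z i)) * H) 0"
    by (simp only: fps_X_mult_nth) simp
  moreover have "fps_nth (\<Prod>i\<in>I. f i) 0 = (\<Prod>i\<in>I. fps_nth (f i) 0)"
    for f :: "nat \<Rightarrow> 'a fps" and I
    by (induction I rule: infinite_finite_induct) simp_all
  ultimately have "1 = (- y) * (\<Prod>i\<in>{1..<p ^ k}. - z i) * fps_nth H 0"
    using Psi_nth_1[OF p_gt_1] by (simp add: nth_map_int_fps)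
  then have "av 1 = av ((- y) * (\<Prod>i\<in>{1..<p ^ k}. - z i) * fps_nth H 0)"
    by (rule arg_cong)
  then have one: "1 = av y * (\<Prod>i\<in>{1..<p ^ k}. av (z i)) * av (fps_nth H 0)"
    by (simp add: av_mult av_minus av_prod)
  have H0: "av (fps_nth H 0) \<le> real p ^ repunit p (Suc k) / ?r / ?r ^ (p ^ k)"
    using H(2)[unfolded gauss_le_def card, rule_format, of 0] by simp
  have rep: "repunit p (Suc k) = repunit p k + p ^ k"
    by (simp add: repunit_def)
  have P0: "(\<Prod>i\<in>{1..<p ^ k}. av (z i)) \<ge> 0"
    by (intro prod_nonneg) (simp add: av_nonneg)
  \<comment> \<open>The repunits cancel up to p^k, leaving the exponent k + k p^k + p^k in the
    numerator; the exponent (k + 1) (1 + p^k) of the denominator is larger by one.\<close>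
  have "1 \<le> real p ^ k * (\<Prod>i\<in>{1..<p ^ k}. av (z i)) * (real p ^ repunit p (Suc k) / ?r / ?r ^ (p ^ k))"
    unfolding one using P0 y H0 by (intro mult_mono) (auto simp: av_nonneg)
  also have "\<dots> = real p ^ k * ((\<Prod>i\<in>{1..<p ^ k}. av (z i)) * real p ^ repunit p k) * real p ^ (p ^ k) / (?r * ?r ^ (p ^ k))"
    by (simp add: rep power_add)
  also have "\<dots> \<le> real p ^ k * real p ^ (k * p ^ k) * real p ^ (p ^ k) / (?r * ?r ^ (p ^ k))"
    using prod_av_z_le by (intro divide_right_mono mult_right_mono mult_left_mono) auto
  also have "\<dots> = real p ^ (k + k * p ^ k + p ^ k) / real p ^ Suc (k + k * p ^ k + p ^ k)"
    by (simp add: power_add power_mult power_mult_distrib mult_ac)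
  also have "\<dots> = 1 / real p"
    using p_gt_1 by simp
  also have "\<dots> < 1"
    using p_gt_1 by simp
  finally show False by simp
qed

text \<open>Both claims come from the quotient G by the factor at y. If y is not among the
  \<open>z i\<close>, or if y is a multiple zero, then every \<open>z i\<close> is a zero of G,
  against \<open>no_further_zero\<close>.\<close>

lemma zero_cases:
  assumes y: "psi y = 0" "av y \<le> real p ^ k"
  shows "y \<in> z ` {..<p ^ k}" and "fps_simple_zero av Psi_av y"
proof -
  have lt: "av y < real p ^ Suc k"
    using y(2) p_gt_1 by (intro le_less_trans[OF y(2)]) simp
  have y0: "fps_zero av Psi_av y"
    using y(1) by (simp add: fps_zero_iff_psi)
  obtain G where G: "Psi_av = (fps_X - fps_const y) * G"
      "gauss_le G (real p ^ Suc k) (real p ^ repunit p (Suc k) / real p ^ Suc k)"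
      "\<And>x. fps_zero av Psi_av x \<Longrightarrow> av x < real p ^ Suc k \<Longrightarrow> x \<noteq> y \<Longrightarrow> fps_zero av G x"
      "\<And>v. fps_has_value av G y v \<Longrightarrow> fps_has_value av (fps_deriv Psi_av) y v"
    by (rule fps_zero_division[OF gauss_le_Psi y0 lt]) (rule that)
  have zeros: "fps_zero av G (z i)" if "i < p ^ k" "z i \<noteq> y" for i
    using that by (intro G(3) av_z_lt) (simp_all add: fps_zero_iff_psi psi_z)
  show "y \<in> z ` {..<p ^ k}"
  proof (rule ccontr)
    assume "y \<notin> z ` {..<p ^ k}"
    then show False
      by (intro no_further_zero[OF G(1,2) y(2)] zeros) auto
  qed
  \<comment> \<open>The value of G at y is that of the derivative of \<Psi>, so simplicity means
    that v is nonzero.\<close>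
  obtain v where v: "fps_has_value av G y v"
    by (rule gauss_le_imp_value[OF G(2) lt])
  have "v \<noteq> 0"
  proof
    assume "v = 0"
    then have "fps_zero av G y"
      using v by (simp add: fps_zero_def)
    then have "fps_zero av G (z i)" if "i < p ^ k" for i
      using zeros[OF that] by (cases "z i = y") simp_all
    then show False
      by (rule no_further_zero[OF G(1,2) y(2)])
  qed
  then show "fps_simple_zero av Psi_av y"
    unfolding fps_simple_zero_def using y0 G(4)[OF v] by blast
qed

end

section \<open>Rationality, simplicity and uniqueness of the zeros\<close>

lemma psi_0: "psi 0 = 0"
proof -
  have "fps_nth Psi_av n * 0 ^ n = 0" for n
    using Psi_nth_0[OF p_gt_1] by (cases n) (simp_all add: nth_map_int_fps)
  then have "fps_zero av Psi_av 0"
    unfolding fps_zero_def fps_has_value_iff_conv by (simp only: sum.neutral_const conv_const)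
  then show ?thesis by (simp add: fps_zero_iff_psi)
qed

lemma obtain_zeros:
  obtains z where "z 0 = 0" "\<And>i. z i \<in> Qp av" "\<And>i. psi (z i) = 0"
    "\<And>i. av (z i - of_nat i / of_nat p ^ k) \<le> 1"
proof -
  \<comment> \<open>For \<open>i = 0\<close> the chosen zero is 0 itself, as the counting argument
    requires.\<close>
  have "\<exists>y. y \<in> Qp av \<and> psi y = 0 \<and> av (y - of_nat i / of_nat p ^ k) \<le> 1 \<and> (i = 0 \<longrightarrow> y = 0)" for i
  proof (cases "i = 0")
    case True
    then show ?thesis using psi_0 Qp_of_int[of 0] by simp
  next
    case False
    have "of_nat i / of_nat p ^ k = (of_rat (of_nat i / of_nat p ^ k) :: 'a)"
      by (simp add: of_rat_divide of_rat_power)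
    then have "of_nat i / of_nat p ^ k \<in> Qp av"
      using Qp_of_rat by simp
    then obtain y where "y \<in> Qp av" "av (y - of_nat i / of_nat p ^ k) \<le> 1" "psi y = 0"
      by (rule psi_zero_exists)
    then show ?thesis using False by blast
  qed
  then obtain z where "\<And>i. z i \<in> Qp av \<and> psi (z i) = 0 \<and>
      av (z i - of_nat i / of_nat p ^ k) \<le> 1 \<and> (i = 0 \<longrightarrow> z i = 0)"
    by metis
  then show ?thesis
    by (intro that[of z]) simp_all
qed

text \<open>Every y lies in a disc of radius p^k, where the zeros already found in Q_p account for
  all zeros.\<close>

lemma zero_in_Qp_simple:
  assumes "psi y = 0"
  shows "y \<in> Qp av" "fps_simple_zero av Psi_av y"
proof -
  obtain k where k: "av y \<le> real p ^ k" by (rule obtain_power_bound)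
  obtain z where z: "z 0 = 0" "\<And>i. z i \<in> Qp av" "\<And>i. psi (z i) = 0"
    "\<And>i. av (z i - of_nat i / of_nat p ^ k) \<le> 1"
    by (rule obtain_zeros[of k]) (rule that)
  show "y \<in> Qp av"
    using zero_cases(1)[where z = z, OF z(1,3,4) assms k] z(2) by blast
  show "fps_simple_zero av Psi_av y"
    by (rule zero_cases(2)[where z = z, OF z(1,3,4) assms k])
qed

text \<open>In a disc containing both points each zero is some \<open>z i\<close>. If
  \<open>z i\<close> and \<open>z j\<close> share a coset of the unit ball, then so do i/p^k and
  j/p^k, which forces i = j.\<close>

lemma zeros_in_coset_eq:
  assumes "psi x = 0" "psi y = 0" "av (x - y) \<le> 1"
  shows "x = y"
proof -
  obtain m where m: "av x \<le> real p ^ m" by (rule obtain_power_bound)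
  obtain n where n: "av y \<le> real p ^ n" by (rule obtain_power_bound)
  define k where "k = max m n"
  have "real p ^ m \<le> real p ^ k" "real p ^ n \<le> real p ^ k"
    using p_gt_1 by (simp_all add: k_def)
  then have k: "av x \<le> real p ^ k" "av y \<le> real p ^ k"
    using m n by linarith+
  obtain z where z: "z 0 = 0" "\<And>i. z i \<in> Qp av" "\<And>i. psi (z i) = 0"
    "\<And>i. av (z i - of_nat i / of_nat p ^ k) \<le> 1"
    by (rule obtain_zeros[of k]) (rule that)
  obtain i where i: "i < p ^ k" "x = z i"
    using zero_cases(1)[where z = z, OF z(1,3,4) assms(1) k(1)] by blast
  obtain j where j: "j < p ^ k" "y = z j"
    using zero_cases(1)[where z = z, OF z(1,3,4) assms(2) k(2)] by blast
  have "of_int (int i - int j) / of_nat p ^ k =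
      (x - y) - (z i - of_nat i / of_nat p ^ k) + (z j - of_nat j / of_nat p ^ k)"
    by (simp add: i j diff_divide_distrib)
  also have "av \<dots> \<le> 1"
    by (rule av_add_le[OF av_diff_le[OF assms(3) z(4)] z(4)])
  finally have "\<not> 1 < av (of_int (int i - int j) / of_nat p ^ k)"
    by simp
  moreover have "\<bar>int i - int j\<bar> < int p ^ k"
    using i(1) j(1) by (auto simp flip: of_nat_power)
  ultimately have "int i - int j = 0"
    using av_of_int_gt[of "int i - int j" k] by (auto simp: av_divide av_p_power)
  then show ?thesis using i j by simp
qed

end

theorem corollary3p14:
  fixes p :: nat and av :: "'a::field_char_0 \<Rightarrow> real"
  assumes "prime p" and "padic_Cp p av"
  shows "(\<forall>x. fps_zero av (map_int_fps (Psi p)) x \<longrightarrow>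
             fps_simple_zero av (map_int_fps (Psi p)) x \<and> x \<in> Qp av) \<and>
         (\<forall>a\<in>Qp av. \<exists>!x. x \<in> (\<lambda>z. a + z) ` Zp av \<and> fps_zero av (map_int_fps (Psi p)) x)"
proof -
  interpret padic_Cp_prime p av
    using assms by (intro padic_Cp_prime.intro padic_Cp_prime_axioms.intro)
  have coset: "x \<in> (\<lambda>z. a + z) ` Zp av \<longleftrightarrow> x \<in> Qp av \<and> av (x - a) \<le> 1" if "a \<in> Qp av" for a x
  proof
    assume "x \<in> (\<lambda>z. a + z) ` Zp av"
    then show "x \<in> Qp av \<and> av (x - a) \<le> 1"
      using that by (auto simp: Zp_def Qp_add)
  next
    assume "x \<in> Qp av \<and> av (x - a) \<le> 1"
    then have "x - a \<in> Zp av"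
      using that by (simp add: Zp_def Qp_diff)
    then show "x \<in> (\<lambda>z. a + z) ` Zp av"
      by (intro image_eqI[of _ _ "x - a"]) simp_all
  qed
  have "\<exists>!x. x \<in> (\<lambda>z. a + z) ` Zp av \<and> fps_zero av (map_int_fps (Psi p)) x" if a: "a \<in> Qp av" for a
  proof -
    obtain z where z: "z \<in> Qp av" "av (z - a) \<le> 1" "psi z = 0"
      by (rule psi_zero_exists[OF a])
    show ?thesis
      unfolding coset[OF a] fps_zero_iff_psi
    proof (rule ex1I[of _ z])
      fix x assume x: "(x \<in> Qp av \<and> av (x - a) \<le> 1) \<and> psi x = 0"
      then have "av ((x - a) - (z - a)) \<le> 1"
        by (intro av_diff_le[OF _ z(2)]) simp
      then show "x = z"
        using x z(3) zeros_in_coset_eq[of x z] by simp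
    qed (use z in simp)
  qed
  then show ?thesis
    using zero_in_Qp_simple by (simp add: fps_zero_iff_psi)
qed

end
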